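(* Let $n,p\ge 1$ be integers, $\theta\in\mathbb{R}^p$, and let $\Sigma$ be a $p\times p$ symmetric positive definite matrix. Let $X\sim\mathcal{N}_p(\theta,\Sigma)$ and $Y\sim\mathcal{N}_{n\times p}(0,I_n\otimes\Sigma)$ be independent. Let $A$ be the symmetric positive definite square root of $\Sigma$, and let $\tilde{Y}=YA^{-1}$. Let $r:\mathbb{R}\to[0,C_1]$ be any bounded differentiable non-negative function with bounded derivative $|r'|\le C_2$, where $C_1,C_2$ are finite constants. Let $S=Y^{\top}Y$, and define $$G=\frac{r^2(X^{\top}S^{+}X)}{(X^{\top}S^{+}X)^2}\,S^{+}XX^{\top}S^{+}S,\qquad H=AGA^{-1}.$$ Let $R=\operatorname{rank}(S)$ and suppose that $\mathrm{P}(R>2)=1$. Then $$\mathrm{E}\left[\left|\operatorname{div}_{\operatorname{vec}(\tilde{Y})}\operatorname{vec}(\tilde{Y}H)\right|\right]<\infty.$$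
   Context: $X$ is a random column vector in $\mathbb{R}^p$. The notation $Y\sim\mathcal{N}_{n\times p}(0,I_n\otimes\Sigma)$ means that $Y$ is an $n\times p$ random matrix whose rows are independent, each distributed as $\mathcal{N}_p(0,\Sigma)$. $M^{+}$ denotes the Moore-Penrose inverse of a matrix $M$, and $\operatorname{vec}$ denotes vectorization of a matrix. The matrix $H$ is regarded as a function of $\tilde{Y}$ and $X$ through $S=Y^{\top}Y=A\tilde{Y}^{\top}\tilde{Y}A$. The divergence is taken with respect to the entries of $\tilde{Y}$ with $X$ held fixed: $$\operatorname{div}_{\operatorname{vec}(\tilde{Y})}\operatorname{vec}(\tilde{Y}H)=\sum_{i=1}^{n}\sum_{j=1}^{p}\frac{\partial(\tilde{Y}H)_{ij}}{\partial\tilde{Y}_{ij}},$$ which is understood almost surely (where $S$ has locally constant rank and $X^{\top}S^{+}X>0$). The expectation is over the joint distribution of $(X,Y)$. *)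

theory Defs
  imports "HOL-Probability.Probability"
begin

definition sym_pos_def :: "real^'p^'p \<Rightarrow> bool" where
  "sym_pos_def A \<longleftrightarrow> transpose A = A \<and> (\<forall>x. x \<noteq> 0 \<longrightarrow> 0 < x \<bullet> (A *v x))"

definition mvn_density :: "real^'p \<Rightarrow> real^'p^'p \<Rightarrow> real^'p \<Rightarrow> real" where
  "mvn_density \<mu> \<Sigma> x =
     exp (- ((x - \<mu>) \<bullet> (matrix_inv \<Sigma> *v (x - \<mu>))) / 2) / sqrt ((2 * pi) ^ CARD('p) * det \<Sigma>)"

definition gaussian_vector ::
  "'w measure \<Rightarrow> ('w \<Rightarrow> real^'p) \<Rightarrow> real^'p \<Rightarrow> real^'p^'p \<Rightarrow> bool" where
  "gaussian_vector M X \<mu> \<Sigma> \<longleftrightarrow> distributed M lborel X (\<lambda>x. ennreal (mvn_density \<mu> \<Sigma> x))"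

(* Rows are indexed by the outer type: Y w $ i is the i-th row of the n x p matrix Y w. *)
definition gaussian_matrix ::
  "'w measure \<Rightarrow> ('w \<Rightarrow> real^'p^'n) \<Rightarrow> real^'p^'p \<Rightarrow> bool" where
  "gaussian_matrix M Y \<Sigma> \<longleftrightarrow>
     Y \<in> borel_measurable M \<and>
     prob_space.indep_vars M (\<lambda>_. borel) (\<lambda>i \<omega>. Y \<omega> $ i) UNIV \<and>
     (\<forall>i. gaussian_vector M (\<lambda>\<omega>. Y \<omega> $ i) 0 \<Sigma>)"

(* The library's indep_var forces both random variables to have the same value type; this is
   its characterisation indep_var_eq with different value types allowed. *)
definition indep_rv :: "'w measure \<Rightarrow> ('w \<Rightarrow> 'a::topological_space) \<Rightarrow> ('w \<Rightarrow> 'b::topological_space) \<Rightarrow> bool" where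
  "indep_rv M X Y \<longleftrightarrow>
     X \<in> borel_measurable M \<and> Y \<in> borel_measurable M \<and>
     prob_space.indep_set M
       (sigma_sets (space M) {X -` B \<inter> space M | B. B \<in> sets borel})
       (sigma_sets (space M) {Y -` B \<inter> space M | B. B \<in> sets borel})"

definition is_mp_inverse :: "real^'n^'m \<Rightarrow> real^'m^'n \<Rightarrow> bool" where
  "is_mp_inverse A B \<longleftrightarrow>
     A ** B ** A = A \<and> B ** A ** B = B \<and>
     transpose (A ** B) = A ** B \<and> transpose (B ** A) = B ** A"

definition mp_inverse :: "real^'n^'m \<Rightarrow> real^'m^'n" where
  "mp_inverse A = (THE B. is_mp_inverse A B)"

lemma is_mp_inverse_unique:
  assumes B: "is_mp_inverse A B" and C: "is_mp_inverse A C"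
  shows "B = C"
proof -
  have AB: "A ** B = A ** C"
  proof -
    have "A ** B = (A ** C) ** (A ** B)"
      using C by (simp add: is_mp_inverse_def matrix_mul_assoc)
    also have "\<dots> = transpose ((A ** B) ** (A ** C))"
      using B C by (simp add: is_mp_inverse_def matrix_transpose_mul)
    also have "\<dots> = transpose (A ** C)"
      using B by (simp add: is_mp_inverse_def matrix_mul_assoc)
    finally show ?thesis using C by (simp add: is_mp_inverse_def)
  qed
  have BA: "B ** A = C ** A"
  proof -
    have "B ** A = (B ** A) ** (C ** A)"
      using C by (metis is_mp_inverse_def matrix_mul_assoc)
    also have "\<dots> = transpose ((C ** A) ** (B ** A))"
      using B C by (simp add: is_mp_inverse_def matrix_transpose_mul)
    also have "\<dots> = transpose (C ** A)"
      using B by (metis is_mp_inverse_def matrix_mul_assoc)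
    finally show ?thesis using C by (simp add: is_mp_inverse_def)
  qed
  have "B = B ** A ** B" using B by (simp add: is_mp_inverse_def)
  also have "\<dots> = C ** A ** C" by (metis AB BA matrix_mul_assoc)
  also have "\<dots> = C" using C by (simp add: is_mp_inverse_def)
  finally show ?thesis .
qed

definition quad_form :: "real^'p^'p \<Rightarrow> real^'p \<Rightarrow> real" where
  "quad_form S x = x \<bullet> (mp_inverse S *v x)"

definition G_mat :: "(real \<Rightarrow> real) \<Rightarrow> real^'p^'p \<Rightarrow> real^'p \<Rightarrow> real^'p^'p" where
  "G_mat r S x =
     ((r (quad_form S x))\<^sup>2 / (quad_form S x)\<^sup>2) *\<^sub>R
       (mp_inverse S ** ((columnvector x :: real^1^'p) ** rowvector x) ** mp_inverse S ** S)"

(* H as a function of the standardised matrix Z = Y A^(-1), for which Y^T Y = A Z^T Z A. *)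
definition H_mat ::
  "(real \<Rightarrow> real) \<Rightarrow> real^'p^'p \<Rightarrow> real^'p^'n \<Rightarrow> real^'p \<Rightarrow> real^'p^'p" where
  "H_mat r A Z x = A ** G_mat r (A ** transpose Z ** Z ** A) x ** matrix_inv A"

definition set_entry :: "real^'p^'n \<Rightarrow> 'n \<Rightarrow> 'p \<Rightarrow> real \<Rightarrow> real^'p^'n" where
  "set_entry Z i j t = (\<chi> k l. if k = i \<and> l = j then t else Z $ k $ l)"

definition diag_partials_exist :: "(real^'p^'n \<Rightarrow> real^'p^'n) \<Rightarrow> real^'p^'n \<Rightarrow> bool" where
  "diag_partials_exist \<Phi> Z \<longleftrightarrow>
     (\<forall>i j. (\<lambda>t. \<Phi> (set_entry Z i j t) $ i $ j) field_differentiable (at (Z $ i $ j)))"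

definition matrix_div :: "(real^'p^'n \<Rightarrow> real^'p^'n) \<Rightarrow> real^'p^'n \<Rightarrow> real" where
  "matrix_div \<Phi> Z =
     (\<Sum>i\<in>UNIV. \<Sum>j\<in>UNIV. deriv (\<lambda>t. \<Phi> (set_entry Z i j t) $ i $ j) (Z $ i $ j))"

end

theory Submission
  imports Defs
begin

text \<open>
  Put \<open>Y = Z ** A\<close>, let \<open>B\<close> be the Moore-Penrose inverse of \<open>Y\<close>, and set \<open>v = transpose B *v x\<close>.
  Since \<open>B ** transpose B\<close> is the Moore-Penrose inverse of \<open>S = transpose Y ** Y\<close>, the quadratic form
  of \<open>x\<close> is \<open>F = v \<bullet> v\<close>, and \<open>Z ** H\<close> collapses to the rank-one expression
  \<open>(r F)\<^sup>2 / F\<^sup>2\<close> times \<open>v v\<^sup>T Z\<close> (\<open>mult_H_mat_entry\<close>). This form is the same whether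
  \<open>n \<ge> p\<close> or \<open>n < p\<close>, so no case distinction on the shape of \<open>Y\<close> is made in the calculus.

  The derivative of \<open>v\<close> comes from an exact identity for the difference of two Moore-Penrose inverses
  (\<open>mp_inverse_difference\<close>), which also shows that \<open>mp_inverse\<close> is continuous wherever the matrix has full
  rank, because there it is locally bounded. Differentiating the rank-one expression and summing over all
  entries, the terms containing the component of \<open>x\<close> orthogonal to the rows of \<open>Y\<close> vanish, and what remains is
  \<open>- 4 * r F * deriv r F + (r F)\<^sup>2 / F * (n + p + 3 - 2 * trace (B ** Y))\<close>
  (\<open>matrix_div_formula\<close>). The boundedness of \<open>r\<close> and \<open>r'\<close> thus reduces the theorem to two facts:
  \<open>Y\<close> has full rank almost surely, and \<open>1 / F\<close> has finite expectation.

  For the first, the law of \<open>Y\<close> is absolutely continuous, and translating in a suitable fixed direction turns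
  rank deficiency into the vanishing of a nonzero polynomial in one variable (\<open>AE_full_rank\<close>). For the second, let
  \<open>P = B ** Y\<close> be the orthogonal projection onto the row space of \<open>Y\<close>. Then \<open>P x = transpose Y *v v\<close>, hence
  \<open>1 / F \<le> (norm Y)\<^sup>2 / (norm (P x))\<^sup>2\<close>. By independence \<open>X\<close> may be integrated first with \<open>Y\<close> fixed. Since
  \<open>P\<close> has rank at least three, \<open>(norm (P x))\<^sup>-\<^sup>2\<close> is integrable against a Gaussian density, with a bound that
  does not depend on \<open>P\<close> (\<open>nn_integral_inverse_projection_gauss\<close>); here the hypothesis on the rank enters.
  The remaining factor \<open>(norm Y)\<^sup>2\<close> has finite expectation.
\<close>

section \<open>The matrix product as a bounded bilinear map\<close>

\<comment> \<open>The default rewriting of \<open>transpose M *v x\<close> into \<open>x v* M\<close> would hide the matrix identities used below.\<close>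
declare transpose_matrix_vector [simp del]

lemma norm_matrix_vector_mult_le:
  fixes M :: "real^'b^'a"
  shows "norm (M *v x) \<le> norm M * norm x"
proof -
  have "norm (M *v x) \<le> L2_set (\<lambda>i. norm (M $ i) * norm x) UNIV"
    unfolding norm_vec_def[of "M *v x"]
    by (intro L2_set_mono) (simp_all add: matrix_vector_mul_component Cauchy_Schwarz_ineq2)
  also have "\<dots> = norm M * norm x"
    by (simp add: norm_vec_def L2_set_left_distrib)
  finally show ?thesis .
qed

lemma norm_sq_matrix: "(norm (M :: real^'b^'a))\<^sup>2 = (\<Sum>i\<in>UNIV. (norm (M $ i))\<^sup>2)"
  by (simp add: norm_vec_def L2_set_def sum_nonneg)

lemma norm_sq_vec: "(norm (x :: real^'a))\<^sup>2 = (\<Sum>i\<in>UNIV. (x $ i)\<^sup>2)"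
  by (simp add: norm_vec_def L2_set_def sum_nonneg)

lemma norm_transpose: "norm (transpose M) = norm (M :: real^'b^'a)"
proof -
  have "(norm (transpose M))\<^sup>2 = (norm M)\<^sup>2"
    unfolding norm_sq_matrix norm_sq_vec by (subst sum.swap) (simp add: transpose_def)
  then show ?thesis by simp
qed

lemma norm_matrix_matrix_mult_le:
  fixes M :: "real^'b^'a" and N :: "real^'c^'b"
  shows "norm (M ** N) \<le> norm M * norm N"
proof -
  have row: "(M ** N) $ i = transpose N *v (M $ i)" for i
    by (simp add: vec_eq_iff matrix_matrix_mult_def matrix_vector_mult_def transpose_def mult.commute
        del: transpose_matrix_vector)
  have "norm (M ** N) \<le> L2_set (\<lambda>i. norm (M $ i) * norm N) UNIV"
    unfolding norm_vec_def[of "M ** N"]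
  proof (intro L2_set_mono)
    fix i show "norm ((M ** N) $ i) \<le> norm (M $ i) * norm N"
      unfolding row using norm_matrix_vector_mult_le[of "transpose N" "M $ i"]
      by (simp add: norm_transpose mult.commute del: transpose_matrix_vector)
  qed simp
  also have "\<dots> = norm M * norm N"
    by (simp add: norm_vec_def[of M] L2_set_left_distrib)
  finally show ?thesis .
qed

lemma bounded_bilinear_matrix_matrix_mult:
  "bounded_bilinear ((**) :: real^'b^'a \<Rightarrow> real^'c^'b \<Rightarrow> real^'c^'a)"
proof (unfold_locales, goal_cases)
  case (5)
  show ?case by (intro exI[of _ 1]) (simp add: norm_matrix_matrix_mult_le)
qed (simp_all add: vec_eq_iff matrix_matrix_mult_def algebra_simps sum.distrib sum_distrib_left)

lemma bounded_bilinear_matrix_vector_mult: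
  "bounded_bilinear ((*v) :: real^'b^'a \<Rightarrow> real^'b \<Rightarrow> real^'a)"
proof (unfold_locales, goal_cases)
  case (5)
  show ?case by (intro exI[of _ 1]) (simp add: norm_matrix_vector_mult_le)
qed (simp_all add: vec_eq_iff matrix_vector_mult_def algebra_simps sum.distrib sum_distrib_left)

lemma bounded_linear_transpose: "bounded_linear (transpose :: real^'b^'a \<Rightarrow> real^'a^'b)"
proof (unfold_locales, goal_cases)
  case (3)
  show ?case by (intro exI[of _ 1]) (simp add: norm_transpose)
qed (simp_all add: vec_eq_iff transpose_def)

lemmas tendsto_matrix_matrix_mult = bounded_bilinear.tendsto[OF bounded_bilinear_matrix_matrix_mult]
lemmas tendsto_matrix_vector_mult = bounded_bilinear.tendsto[OF bounded_bilinear_matrix_vector_mult]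
lemmas tendsto_transpose = bounded_linear.tendsto[OF bounded_linear_transpose]
lemmas continuous_on_matrix_matrix_mult = bounded_bilinear.continuous_on[OF bounded_bilinear_matrix_matrix_mult]
lemmas continuous_on_matrix_vector_mult = bounded_bilinear.continuous_on[OF bounded_bilinear_matrix_vector_mult]
lemmas continuous_on_transpose = bounded_linear.continuous_on[OF bounded_linear_transpose]
lemmas matrix_matrix_mult_distribs =
  bounded_bilinear.diff_left[OF bounded_bilinear_matrix_matrix_mult]
  bounded_bilinear.diff_right[OF bounded_bilinear_matrix_matrix_mult]
  bounded_bilinear.add_left[OF bounded_bilinear_matrix_matrix_mult]
  bounded_bilinear.add_right[OF bounded_bilinear_matrix_matrix_mult]
  bounded_bilinear.minus_left[OF bounded_bilinear_matrix_matrix_mult]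
  bounded_bilinear.minus_right[OF bounded_bilinear_matrix_matrix_mult]
lemmas transpose_distribs =
  linear_diff[OF bounded_linear.linear[OF bounded_linear_transpose]]
  linear_add[OF bounded_linear.linear[OF bounded_linear_transpose]]
  matrix_transpose_mul

lemma inner_transpose_mult: "x \<bullet> (M *v y) = (transpose M *v x) \<bullet> (y :: real^'b)" for M :: "real^'b^'a"
  by (simp add: transpose_matrix_vector dot_lmul_matrix)

section \<open>Moore-Penrose inverses of matrices of full rank\<close>

text \<open>Stated through Gram determinants, so that full rank is visibly an open condition and fails only on the zero set of
  a polynomial in the entries; the two alternatives are full column rank and full row rank.\<close>

definition full_rank :: "real^'b^'a \<Rightarrow> bool" where
  "full_rank Y \<longleftrightarrow> det (transpose Y ** Y) \<noteq> 0 \<or> det (Y ** transpose Y) \<noteq> 0"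

lemma full_rank_transpose [simp]: "full_rank (transpose Y) \<longleftrightarrow> full_rank Y"
  by (auto simp: full_rank_def)

lemma mp_inverse_eqI: "is_mp_inverse M N \<Longrightarrow> mp_inverse M = N"
  unfolding mp_inverse_def using is_mp_inverse_unique by blast

lemma is_mp_inverse_transpose: "is_mp_inverse M N \<Longrightarrow> is_mp_inverse (transpose M) (transpose N)"
  unfolding is_mp_inverse_def by (metis matrix_transpose_mul matrix_mul_assoc transpose_transpose)

lemma matrix_inv_mult:
  assumes "det (M :: real^'a^'a) \<noteq> 0"
  shows "matrix_inv M ** M = mat 1" "M ** matrix_inv M = mat 1"
proof -
  have "\<exists>M'. M ** M' = mat 1 \<and> M' ** M = mat 1"
    using assms by (simp add: invertible_det_nz[symmetric] invertible_def)
  then have "M ** matrix_inv M = mat 1 \<and> matrix_inv M ** M = mat 1"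
    unfolding matrix_inv_def by (rule someI_ex)
  then show "matrix_inv M ** M = mat 1" "M ** matrix_inv M = mat 1" by auto
qed

lemma transpose_inverse_of_symmetric:
  assumes "transpose M = M" and "N ** M = mat 1" 
  shows "transpose N = (N :: real^'a^'a)"
proof -
  have "M ** transpose N = mat 1" using arg_cong[OF assms(2), of transpose] assms(1)
    by (simp add: matrix_transpose_mul)
  then have "(N ** M) ** transpose N = N" by (simp add: matrix_mul_assoc[symmetric])
  then show ?thesis using assms(2) by simp
qed

text \<open>The familiar formula \<open>(Y\<^sup>T Y)\<^sup>-\<^sup>1 Y\<^sup>T\<close>.\<close>

lemma left_mp_inverse:
  fixes Y :: "real^'b^'a"
  assumes "det (transpose Y ** Y) \<noteq> 0"
  obtains B where "is_mp_inverse Y B" "B ** Y = mat 1"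
proof -
  define N where "N = matrix_inv (transpose Y ** Y)"
  have inv: "N ** (transpose Y ** Y) = mat 1"
    using matrix_inv_mult[OF assms] by (simp add: N_def)
  have sym: "transpose N = N"
    using inv by (rule transpose_inverse_of_symmetric[rotated]) (simp only: matrix_transpose_mul transpose_transpose)
  have one: "N ** transpose Y ** Y = mat 1"
    using inv by (simp only: matrix_mul_assoc)
  have "Y ** (N ** transpose Y) ** Y = Y ** (N ** transpose Y ** Y)"
    by (simp only: matrix_mul_assoc)
  then have "Y ** (N ** transpose Y) ** Y = Y"
    by (simp only: one matrix_mul_rid)
  then have "is_mp_inverse Y (N ** transpose Y)"
    unfolding is_mp_inverse_def
    by (simp only: one sym matrix_transpose_mul transpose_transpose transpose_mat matrix_mul_lid matrix_mul_assoc simp_thms)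
  with one show ?thesis using that by blast
qed

text \<open>Full row rank reduces to full column rank by transposing. The one-sided inverse property is what makes
  \<open>mp_inverse\<close> locally bounded below and fixes the trace of \<open>mp_inverse Y ** Y\<close>.\<close>

lemma full_rank_mp_inverse:
  fixes Y :: "real^'b^'a"
  assumes "full_rank Y"
  shows "is_mp_inverse Y (mp_inverse Y)" and "mp_inverse Y ** Y = mat 1 \<or> Y ** mp_inverse Y = mat 1"
proof -
  have "\<exists>B. is_mp_inverse Y B \<and> (B ** Y = mat 1 \<or> Y ** B = mat 1)"
  proof (cases "det (transpose Y ** Y) = 0")
    case False
    then show ?thesis using left_mp_inverse[of Y] by metis
  next
    case True
    then have "det (transpose (transpose Y) ** transpose Y) \<noteq> 0"
      using assms by (simp add: full_rank_def)
    from left_mp_inverse[OF this] obtain B where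
      B: "is_mp_inverse (transpose Y) B" "B ** transpose Y = mat 1" by blast
    then have "is_mp_inverse Y (transpose B)"
      using is_mp_inverse_transpose by fastforce
    moreover have "Y ** transpose B = mat 1"
      using arg_cong[OF B(2), of transpose] by (simp add: matrix_transpose_mul)
    ultimately show ?thesis by blast
  qed
  then obtain B where B: "is_mp_inverse Y B" "B ** Y = mat 1 \<or> Y ** B = mat 1" by blast
  with mp_inverse_eqI[of Y B] show "is_mp_inverse Y (mp_inverse Y)"
    "mp_inverse Y ** Y = mat 1 \<or> Y ** mp_inverse Y = mat 1" by auto
qed

lemma mp_inverse_transpose:
  "full_rank Y \<Longrightarrow> mp_inverse (transpose Y) = transpose (mp_inverse Y)"
  by (intro mp_inverse_eqI is_mp_inverse_transpose full_rank_mp_inverse)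

lemma mp_inverse_projection_facts:
  assumes "is_mp_inverse (Y :: real^'b^'a) B"
  shows "Y ** B ** Y = Y" "B ** Y ** B = B" "transpose (Y ** B) = Y ** B" "transpose (B ** Y) = B ** Y"
    "transpose B ** transpose Y = Y ** B" "transpose Y ** transpose B = B ** Y"
    "transpose Y ** Y ** B = transpose Y" "B ** Y ** transpose Y = transpose Y"
    "Y ** B ** transpose B = transpose B" "transpose B ** B ** Y = transpose B"
proof -
  show a: "Y ** B ** Y = Y" "B ** Y ** B = B" "transpose (Y ** B) = Y ** B" "transpose (B ** Y) = B ** Y"
    using assms by (auto simp: is_mp_inverse_def)
  show "transpose B ** transpose Y = Y ** B" "transpose Y ** transpose B = B ** Y"
    using a(3,4) by (auto simp: matrix_transpose_mul)
  show "transpose Y ** Y ** B = transpose Y" "B ** Y ** transpose Y = transpose Y"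
    by (metis a(1,3) matrix_transpose_mul matrix_mul_assoc, metis a(1,4) matrix_transpose_mul matrix_mul_assoc)
  show "Y ** B ** transpose B = transpose B" "transpose B ** B ** Y = transpose B"
    by (metis a(2,3) matrix_transpose_mul matrix_mul_assoc, metis a(2,4) matrix_transpose_mul matrix_mul_assoc)
qed

text \<open>This expresses the Moore-Penrose inverse of \<open>S = Y\<^sup>T Y\<close>, on which the shrinkage matrix is built, through that of \<open>Y\<close>;
  both products of the two Gram matrices are the projection \<open>B ** Y\<close>.\<close>

lemma is_mp_inverse_gram:
  fixes Y :: "real^'b^'a"
  assumes "is_mp_inverse Y B"
  shows "is_mp_inverse (transpose Y ** Y) (B ** transpose B)"
proof -
  note f = mp_inverse_projection_facts[OF assms]
  have c: "transpose Y ** Y ** (B ** transpose B) = B ** Y"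
    by (simp only: matrix_mul_assoc f)
  have "B ** transpose B ** (transpose Y ** Y) = B ** (transpose B ** transpose Y) ** Y"
    by (simp only: matrix_mul_assoc)
  also have "\<dots> = B ** Y"
    by (simp only: matrix_mul_assoc f)
  finally have d: "B ** transpose B ** (transpose Y ** Y) = B ** Y" .
  show ?thesis
    unfolding is_mp_inverse_def c d by (simp only: matrix_mul_assoc f simp_thms)
qed

section \<open>Perturbation of the Moore-Penrose inverse\<close>

text \<open>An exact, not merely first-order, expansion: both corrections arise by inserting the projections \<open>Y0 ** B0\<close> and
  \<open>B1 ** Y1\<close> and using that their complements annihilate \<open>Y0\<^sup>T\<close> and \<open>Y1\<^sup>T\<close>. Being exact, it
  yields both continuity and differentiability of the Moore-Penrose inverse as soon as a local bound is known.\<close>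

lemma mp_inverse_difference:
  fixes Y0 Y1 :: "real^'b^'a"
  assumes "is_mp_inverse Y0 B0" "is_mp_inverse Y1 B1"
  shows "B1 - B0 = - (B1 ** (Y1 - Y0) ** B0)
    + B1 ** transpose B1 ** transpose (Y1 - Y0) ** (mat 1 - Y0 ** B0)
    + (mat 1 - B1 ** Y1) ** transpose (Y1 - Y0) ** transpose B0 ** B0"
proof -
  note f0 = mp_inverse_projection_facts[OF assms(1)] and f1 = mp_inverse_projection_facts[OF assms(2)]
  have z: "transpose Y0 ** (mat 1 - Y0 ** B0) = 0" "(mat 1 - B1 ** Y1) ** transpose Y1 = 0"
    by (simp_all only: matrix_matrix_mult_distribs matrix_mul_assoc f0 f1 matrix_mul_lid matrix_mul_rid diff_self)
  have a: "transpose (Y1 - Y0) ** (mat 1 - Y0 ** B0) = transpose Y1 ** (mat 1 - Y0 ** B0)"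
    "(mat 1 - B1 ** Y1) ** transpose (Y1 - Y0) = - ((mat 1 - B1 ** Y1) ** transpose Y0)"
    unfolding transpose_distribs matrix_matrix_mult_distribs(1)[of "transpose Y1"] matrix_matrix_mult_distribs(2)[of _ "transpose Y1"] z
    by simp_all
  have "B1 ** transpose B1 ** transpose (Y1 - Y0) ** (mat 1 - Y0 ** B0)
      = B1 ** (transpose B1 ** transpose Y1) ** (mat 1 - Y0 ** B0)"
    by (simp only: a(1) matrix_mul_assoc[symmetric])
  also have "\<dots> = B1 - B1 ** Y0 ** B0"
    by (simp only: f1 matrix_mul_assoc matrix_matrix_mult_distribs matrix_mul_rid)
  finally have 2: "B1 ** transpose B1 ** transpose (Y1 - Y0) ** (mat 1 - Y0 ** B0) = B1 - B1 ** Y0 ** B0" .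
  have "(mat 1 - B1 ** Y1) ** transpose (Y1 - Y0) ** transpose B0 ** B0
     = - ((mat 1 - B1 ** Y1) ** ((transpose Y0 ** transpose B0) ** B0))"
    by (simp only: a(2) matrix_mul_assoc matrix_matrix_mult_distribs(5))
  also have "\<dots> = - B0 + B1 ** Y1 ** B0"
    unfolding f0 by (simp add: matrix_mul_assoc matrix_matrix_mult_distribs)
  finally show ?thesis unfolding 2 by (simp add: matrix_matrix_mult_distribs matrix_mul_assoc)
qed

lemma norm_projection_le:
  fixes P :: "real^'a^'a"
  assumes "transpose P = P" "P ** P = P"
  shows "norm (P *v x) \<le> norm x"
proof -
  have "(norm (P *v x))\<^sup>2 = x \<bullet> (P *v x)"
    using assms unfolding power2_norm_eq_inner
    by (subst inner_commute, subst inner_transpose_mult)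
       (simp add: matrix_vector_mul_assoc inner_commute)
  also have "\<dots> \<le> norm x * norm (P *v x)" using norm_cauchy_schwarz by blast
  finally show ?thesis by (auto simp: power2_eq_square mult_le_cancel_right)
qed

lemma norm_projection_matrix_le:
  fixes P :: "real^'a^'a"
  assumes "transpose P = P" "P ** P = P"
  shows "norm P \<le> CARD('a)"
proof -
  have "norm P = norm (transpose P)" using assms by simp
  also have "\<dots> \<le> (\<Sum>i\<in>UNIV. norm (transpose P $ i))" 
    unfolding norm_vec_def[of "transpose P"] by (rule L2_set_le_sum) simp
  also have "\<dots> \<le> (\<Sum>i\<in>(UNIV :: 'a set). 1)"
  proof (rule sum_mono)
    fix i
    have "transpose P $ i = P *v axis i 1"
      by (simp add: vec_eq_iff transpose_def matrix_vector_mult_def axis_def if_distrib cong: if_cong)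
    then show "norm (transpose P $ i) \<le> 1" using norm_projection_le[OF assms, of "axis i 1"] by simp
  qed
  finally show ?thesis by simp
qed

text \<open>If \<open>B0\<close> is a left inverse of \<open>Y0\<close>, then \<open>B1 = B0 (Y1 B1) - B0 (Y1 - Y0) B1\<close>. The first summand is bounded because
  \<open>Y1 B1\<close> is an orthogonal projection, and for \<open>Y1\<close> close to \<open>Y0\<close> the second is absorbed into the left-hand side.\<close>

lemma mp_inverse_locally_bounded:
  fixes Y0 Y1 :: "real^'b^'a"
  assumes "B0 ** Y0 = mat 1" "is_mp_inverse Y1 B1" "norm B0 * norm (Y1 - Y0) \<le> 1 / 2"
  shows "norm B1 \<le> 2 * norm B0 * CARD('a)"
proof -
  note f1 = mp_inverse_projection_facts[OF assms(2)]
  have "norm (Y1 ** B1) \<le> CARD('a)"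
    by (intro norm_projection_matrix_le) (simp_all only: f1 matrix_mul_assoc)
  have "B1 = B0 ** (Y1 ** B1) - B0 ** (Y1 - Y0) ** B1"
    by (simp add: matrix_matrix_mult_distribs matrix_mul_assoc assms(1))
  then have "norm B1 \<le> norm (B0 ** (Y1 ** B1)) + norm (B0 ** (Y1 - Y0) ** B1)"
    by (metis norm_triangle_ineq4)
  also have "\<dots> \<le> norm B0 * CARD('a) + norm B0 * norm (Y1 - Y0) * norm B1"
    by (intro add_mono order_trans[OF norm_matrix_matrix_mult_le] mult_left_mono mult_right_mono
      \<open>norm (Y1 ** B1) \<le> _\<close> norm_matrix_matrix_mult_le) auto
  also have "\<dots> \<le> norm B0 * CARD('a) + 1 / 2 * norm B1"
    using assms(3) by (intro add_mono mult_right_mono) auto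
  finally show ?thesis by simp
qed

lemma continuous_on_det [continuous_intros]:
  fixes f :: "'x::topological_space \<Rightarrow> real^'a^'a"
  assumes "continuous_on S f"
  shows "continuous_on S (\<lambda>x. det (f x))"
  unfolding det_def using assms by (intro continuous_intros)

lemma open_full_rank: "open {Y :: real^'b^'a. full_rank Y}"
proof -
  have "open {Y :: real^'b^'a. det (transpose Y ** Y) \<noteq> 0}" "open {Y :: real^'b^'a. det (Y ** transpose Y) \<noteq> 0}"
    by (intro open_Collect_neq continuous_on_det continuous_on_matrix_matrix_mult continuous_on_transpose continuous_on_id continuous_on_const)+
  then show ?thesis
    unfolding full_rank_def Collect_disj_eq by (rule open_Un)
qed

text \<open>The three terms of the expansion bound the difference by a multiple \<open>K\<close> of \<open>norm (Y - Y0)\<close>; \<open>C\<close> is the local bound for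
  the inverse nearby.\<close>

lemma tendsto_mp_inverse_injective:
  fixes Y0 :: "real^'b^'a"
  assumes "full_rank Y0" "mp_inverse Y0 ** Y0 = mat 1"
  shows "(mp_inverse \<longlongrightarrow> mp_inverse Y0) (at Y0)"
proof -
  let ?B = "mp_inverse Y0"
  define C where "C = 2 * norm ?B * CARD('a)"
  define K where "K = C * norm ?B + C * C * norm (mat 1 - Y0 ** ?B)
    + (norm (mat 1 :: real^'b^'b) + CARD('b)) * (norm ?B * norm ?B)"
  have ev1: "\<forall>\<^sub>F Y in at Y0. full_rank Y"
    using open_full_rank assms(1) eventually_at_topological by blast
  have "((\<lambda>Y. norm ?B * norm (Y - Y0)) \<longlongrightarrow> norm ?B * norm (Y0 - Y0)) (at Y0)"
    by (intro tendsto_intros)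
  then have ev2: "\<forall>\<^sub>F Y in at Y0. norm ?B * norm (Y - Y0) < 1 / 2"
    by (rule order_tendstoD) simp
  have "\<forall>\<^sub>F Y in at Y0. norm (mp_inverse Y - ?B) \<le> K * norm (Y - Y0)"
    using ev1 ev2
  proof eventually_elim
    case (elim Y)
    let ?A = "mp_inverse Y" and ?D = "Y - Y0"
    note mp0 = full_rank_mp_inverse(1)[OF assms(1)] and mp1 = full_rank_mp_inverse(1)[OF elim(1)]
    note f1 = mp_inverse_projection_facts[OF mp1]
    have A: "norm ?A \<le> C"
      unfolding C_def using mp_inverse_locally_bounded[OF assms(2) mp1] elim(2) by simp
    have C: "0 \<le> C" by (simp add: C_def)
    have "norm (?A ** Y) \<le> CARD('b)"
      by (intro norm_projection_matrix_le) (simp_all only: f1 matrix_mul_assoc)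
    then have Q: "norm (mat 1 - ?A ** Y) \<le> norm (mat 1 :: real^'b^'b) + CARD('b)"
      using norm_triangle_ineq4[of "mat 1 :: real^'b^'b" "?A ** Y"] by linarith
    have t1: "norm (- (?A ** ?D ** ?B)) \<le> C * norm ?D * norm ?B"
      unfolding norm_minus_cancel
      by (intro order_trans[OF norm_matrix_matrix_mult_le] mult_mono A order_refl) (auto simp: C)
    have t2: "norm (?A ** transpose ?A ** transpose ?D ** (mat 1 - Y0 ** ?B)) \<le> C * C * norm ?D * norm (mat 1 - Y0 ** ?B)"
      by (intro order_trans[OF norm_matrix_matrix_mult_le] mult_mono)
        (auto simp: C A norm_transpose)
    have t3: "norm ((mat 1 - ?A ** Y) ** transpose ?D ** transpose ?B ** ?B)
      \<le> (norm (mat 1 :: real^'b^'b) + CARD('b)) * norm ?D * norm ?B * norm ?B"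
      by (intro order_trans[OF norm_matrix_matrix_mult_le] mult_mono Q) (auto simp: norm_transpose)
    have "norm (?A - ?B) \<le> C * norm ?D * norm ?B + C * C * norm ?D * norm (mat 1 - Y0 ** ?B)
      + (norm (mat 1 :: real^'b^'b) + CARD('b)) * norm ?D * norm ?B * norm ?B"
      unfolding mp_inverse_difference[OF mp0 mp1]
      by (intro order_trans[OF norm_triangle_ineq] add_mono t1 t2 t3)
    then show ?case by (simp add: K_def algebra_simps)
  qed
  moreover have "((\<lambda>Y. K * norm (Y - Y0)) \<longlongrightarrow> K * norm (Y0 - Y0)) (at Y0)"
    by (intro tendsto_intros)
  then have "((\<lambda>Y. K * norm (Y - Y0)) \<longlongrightarrow> 0) (at Y0)" by simp
  ultimately have "((\<lambda>Y. mp_inverse Y - ?B) \<longlongrightarrow> 0) (at Y0)"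
    by (rule Lim_null_comparison)
  then show ?thesis using Lim_null by blast
qed

text \<open>The case of full row rank is transported from that of full column rank by transposition.\<close>

lemma isCont_mp_inverse:
  fixes Y0 :: "real^'b^'a"
  assumes "full_rank Y0"
  shows "isCont mp_inverse Y0"
proof (cases "mp_inverse Y0 ** Y0 = mat 1")
  case True
  then show ?thesis using tendsto_mp_inverse_injective[OF assms] by (simp add: isCont_def)
next
  case False
  then have "Y0 ** mp_inverse Y0 = mat 1" using full_rank_mp_inverse(2)[OF assms] by blast
  then have "mp_inverse (transpose Y0) ** transpose Y0 = mat 1"
    using matrix_transpose_mul[of Y0 "mp_inverse Y0"] by (simp add: mp_inverse_transpose[OF assms])
  then have cont: "isCont mp_inverse (transpose Y0)"
    using tendsto_mp_inverse_injective[of "transpose Y0"] assms by (simp add: isCont_def)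
  have "(transpose \<longlongrightarrow> transpose Y0) (at Y0)"
    by (intro tendsto_transpose tendsto_ident_at)
  from tendsto_transpose[OF isCont_tendsto_compose[OF cont this]]
  have lim: "((\<lambda>Y. transpose (mp_inverse (transpose Y))) \<longlongrightarrow> mp_inverse Y0) (at Y0)"
    by (simp add: mp_inverse_transpose[OF assms])
  have "\<forall>\<^sub>F Y in at Y0. full_rank Y"
    using open_full_rank assms eventually_at_topological by blast
  then have "\<forall>\<^sub>F Y in at Y0. transpose (mp_inverse (transpose Y)) = mp_inverse Y"
    by eventually_elim (simp add: mp_inverse_transpose)
  then show ?thesis
    unfolding isCont_def using lim by (rule Lim_transform_eventually[rotated])
qed

lemma continuous_on_mp_inverse: "continuous_on {Y. full_rank Y} mp_inverse"
  using isCont_mp_inverse by (auto intro: continuous_at_imp_continuous_on)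

text \<open>Setting the value to zero off the open set of full-rank matrices makes Borel measurability immediate from continuity on
  that set; the exceptional set is negligible for all laws considered.\<close>

definition pinv :: "real^'b^'a \<Rightarrow> real^'a^'b" where
  "pinv Y = (if full_rank Y then mp_inverse Y else 0)"

lemma borel_measurable_pinv [measurable]: "(pinv :: real^'b^'a \<Rightarrow> real^'a^'b) \<in> borel_measurable borel"
proof -
  have "(\<lambda>Y :: real^'b^'a. if Y \<in> {Y. full_rank Y} then mp_inverse Y else 0) \<in> borel_measurable borel"
    by (intro borel_measurable_continuous_on_if continuous_on_mp_inverse continuous_on_const borel_open open_full_rank)
  then show ?thesis by (simp add: pinv_def[abs_def])
qed

section \<open>The divergence\<close>

text \<open>The vector \<open>v = (Y\<^sup>+)\<^sup>T x\<close>, whose squared norm is the quadratic form \<open>x\<^sup>T (Y\<^sup>T Y)\<^sup>+ x\<close>.\<close>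

definition mp_coord :: "real^'p \<Rightarrow> real^'p^'n \<Rightarrow> real^'n" where
  "mp_coord x Y = transpose (mp_inverse Y) *v x"

lemma quad_form_gram:
  assumes "full_rank Y"
  shows "mp_inverse (transpose Y ** Y) = mp_inverse Y ** transpose (mp_inverse Y)"
    and "quad_form (transpose Y ** Y) x = mp_coord x Y \<bullet> mp_coord x Y"
proof -
  show eq: "mp_inverse (transpose Y ** Y) = mp_inverse Y ** transpose (mp_inverse Y)"
    by (intro mp_inverse_eqI is_mp_inverse_gram full_rank_mp_inverse assms)
  show "quad_form (transpose Y ** Y) x = mp_coord x Y \<bullet> mp_coord x Y"
    unfolding quad_form_def eq mp_coord_def
    by (simp add: matrix_vector_mul_assoc[symmetric] inner_transpose_mult[of x])
qed

lemma rowvector_mult: "rowvector x ** M = rowvector (transpose M *v x)"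
  for M :: "real^'b^'a" and x :: "real^'a"
  by (metis dot_rowvector_columnvector matrix_transpose_mul transpose_columnvector transpose_rowvector transpose_transpose)

text \<open>The identity \<open>Z H = (r F)\<^sup>2 / F\<^sup>2 v v\<^sup>T Z\<close>: on the left \<open>Y B B\<^sup>T\<close> contracts to \<open>B\<^sup>T\<close>, and on the right
  \<open>B B\<^sup>T Y\<^sup>T Y A\<^sup>-\<^sup>1\<close> contracts to \<open>B Z\<close>.\<close>

lemma mult_H_mat_entry:
  fixes Z :: "real^'p^'n" and A :: "real^'p^'p" and x :: "real^'p"
  assumes sym: "transpose A = A" and inv: "A ** matrix_inv A = mat 1" and full: "full_rank (Z ** A)"
  defines "v \<equiv> mp_coord x (Z ** A)"
  shows "(Z ** H_mat r A Z x) $ i $ j = (r (v \<bullet> v))\<^sup>2 / (v \<bullet> v)\<^sup>2 * v $ i * (\<Sum>k\<in>UNIV. Z $ k $ j * v $ k)"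
proof -
  define Y where "Y = Z ** A"
  define B where "B = mp_inverse Y"
  have full': "full_rank Y" using full by (simp add: Y_def)
  note f = mp_inverse_projection_facts[OF full_rank_mp_inverse(1)[OF full'], folded B_def]
  have v: "v = transpose B *v x" by (simp add: v_def mp_coord_def B_def Y_def)
  have S: "A ** transpose Z ** Z ** A = transpose Y ** Y"
    by (simp add: Y_def matrix_transpose_mul sym matrix_mul_assoc)
  have mp: "mp_inverse (transpose Y ** Y) = B ** transpose B"
    using quad_form_gram(1)[OF full'] by (simp add: B_def)
  have q: "quad_form (transpose Y ** Y) x = v \<bullet> v"
    using quad_form_gram(2)[OF full', of x] by (simp add: v_def Y_def)
  define c where "c = (r (v \<bullet> v))\<^sup>2 / (v \<bullet> v)\<^sup>2"
  have 1: "Z ** A ** B ** transpose B = transpose B"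
    using f(9) by (simp add: Y_def)
  have "B ** transpose B ** transpose Y ** Y ** matrix_inv A = B ** (transpose B ** transpose Y) ** Y ** matrix_inv A"
    by (simp only: matrix_mul_assoc)
  also have "\<dots> = B ** Y ** matrix_inv A" by (simp only: f matrix_mul_assoc)
  also have "\<dots> = B ** (Z ** (A ** matrix_inv A))" by (simp only: Y_def matrix_mul_assoc)
  also have "\<dots> = B ** Z" by (simp add: inv)
  finally have 2: "B ** transpose B ** transpose Y ** Y ** matrix_inv A = B ** Z" .
  have "Z ** H_mat r A Z x = c *\<^sub>R (Z ** (A ** (B ** transpose B ** ((columnvector x :: real^1^'p) ** rowvector x) ** (B ** transpose B) ** (transpose Y ** Y)) ** matrix_inv A))"
    unfolding H_mat_def G_mat_def S q mp c_def[symmetric]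
    by (simp add: bounded_bilinear.scaleR_left[OF bounded_bilinear_matrix_matrix_mult]
        bounded_bilinear.scaleR_right[OF bounded_bilinear_matrix_matrix_mult])
  also have "Z ** (A ** (B ** transpose B ** ((columnvector x :: real^1^'p) ** rowvector x) ** (B ** transpose B) ** (transpose Y ** Y)) ** matrix_inv A)
    = (Z ** A ** B ** transpose B) ** (columnvector x :: real^1^'p) ** (rowvector x ** (B ** transpose B ** transpose Y ** Y ** matrix_inv A))"
    by (simp only: matrix_mul_assoc)
  also have "\<dots> = (columnvector v :: real^1^'n) ** (rowvector v ** Z)"
    unfolding 1 2 by (simp only: matrix_mul_assoc dot_rowvector_columnvector[symmetric] rowvector_mult v)
  finally have "Z ** H_mat r A Z x = c *\<^sub>R ((columnvector v :: real^1^'n) ** (rowvector v ** Z))" .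
  then show ?thesis
    by (simp add: c_def matrix_matrix_mult_def columnvector_def rowvector_def sum_distrib_left mult_ac)
qed

text \<open>The transposed perturbation identity applied to \<open>x\<close>, in a form where division by \<open>h\<close> and passing to the limit give the derivative.\<close>

lemma mp_coord_difference:
  fixes Y0 Y1 :: "real^'p^'n"
  assumes "full_rank Y0" "full_rank Y1" "Y1 = Y0 + h *\<^sub>R D"
  shows "mp_coord x Y1 - mp_coord x Y0 = h *\<^sub>R
    (- (transpose (mp_inverse Y0) *v (transpose D *v mp_coord x Y1))
     + (mat 1 - Y0 ** mp_inverse Y0) *v (D *v (mp_inverse Y1 *v mp_coord x Y1))
     + transpose (mp_inverse Y0) *v (mp_inverse Y0 *v (D *v ((mat 1 - mp_inverse Y1 ** Y1) *v x))))"
proof -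
  let ?B0 = "mp_inverse Y0" and ?B1 = "mp_inverse Y1"
  note mp0 = full_rank_mp_inverse(1)[OF assms(1)] and mp1 = full_rank_mp_inverse(1)[OF assms(2)]
  note f0 = mp_inverse_projection_facts[OF mp0] and f1 = mp_inverse_projection_facts[OF mp1]
  have D: "Y1 - Y0 = h *\<^sub>R D" using assms(3) by simp
  have "transpose ?B1 - transpose ?B0 = transpose (?B1 - ?B0)"
    by (simp add: transpose_distribs)
  also have "\<dots> = h *\<^sub>R (- (transpose ?B0 ** transpose D ** transpose ?B1)
    + (mat 1 - Y0 ** ?B0) ** D ** ?B1 ** transpose ?B1
    + transpose ?B0 ** ?B0 ** D ** (mat 1 - ?B1 ** Y1))"
    unfolding mp_inverse_difference[OF mp0 mp1] D
    by (simp add: transpose_distribs transpose_scalar f0(5) f1(6) matrix_mul_assoc scaleR_add_right scaleR_diff_right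
        linear_neg[OF bounded_linear.linear[OF bounded_linear_transpose]]
        bounded_bilinear.scaleR_left[OF bounded_bilinear_matrix_matrix_mult]
        bounded_bilinear.scaleR_right[OF bounded_bilinear_matrix_matrix_mult])
  finally have "mp_coord x Y1 - mp_coord x Y0 = (h *\<^sub>R (- (transpose ?B0 ** transpose D ** transpose ?B1)
    + (mat 1 - Y0 ** ?B0) ** D ** ?B1 ** transpose ?B1
    + transpose ?B0 ** ?B0 ** D ** (mat 1 - ?B1 ** Y1))) *v x"
    unfolding mp_coord_def by (metis matrix_vector_mult_diff_rdistrib)
  also have "\<dots> = h *\<^sub>R ((- (transpose ?B0 ** transpose D ** transpose ?B1)
    + (mat 1 - Y0 ** ?B0) ** D ** ?B1 ** transpose ?B1
    + transpose ?B0 ** ?B0 ** D ** (mat 1 - ?B1 ** Y1)) *v x)"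
    by (simp only: scaleR_matrix_vector_assoc)
  finally show ?thesis
    by (simp only: mp_coord_def matrix_vector_mult_add_rdistrib matrix_vector_mul_assoc
        bounded_bilinear.minus_left[OF bounded_bilinear_matrix_vector_mult] matrix_mul_assoc)
qed

text \<open>The limit of the bracket in the expansion of \<open>mp_coord x Y1 - mp_coord x Y\<close> as \<open>Y1\<close> tends to \<open>Y\<close>.\<close>

definition mp_coord_deriv :: "real^'p \<Rightarrow> real^'p^'n \<Rightarrow> real^'p^'n \<Rightarrow> real^'n" where
  "mp_coord_deriv x Y D =
     - (transpose (mp_inverse Y) *v (transpose D *v mp_coord x Y))
     + (mat 1 - Y ** mp_inverse Y) *v (D *v (mp_inverse Y *v mp_coord x Y))
     + transpose (mp_inverse Y) *v (mp_inverse Y *v (D *v ((mat 1 - mp_inverse Y ** Y) *v x)))"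

lemma eventually_full_rank_line:
  fixes Y :: "real^'p^'n"
  assumes "full_rank Y"
  shows "\<forall>\<^sub>F t in at s. full_rank (Y + (t - s) *\<^sub>R D)"
proof -
  have "((\<lambda>t. Y + (t - s) *\<^sub>R D) \<longlongrightarrow> Y + (s - s) *\<^sub>R D) (at s)"
    by (intro tendsto_intros)
  then show ?thesis
    using topological_tendstoD[OF _ open_full_rank, of "\<lambda>t. Y + (t - s) *\<^sub>R D" "Y + (s - s) *\<^sub>R D" "at s"] assms
    by simp
qed

lemma has_derivative_mp_coord:
  fixes Y :: "real^'p^'n"
  assumes "full_rank Y"
  shows "((\<lambda>t. mp_coord x (Y + (t - s) *\<^sub>R D) $ k) has_real_derivative mp_coord_deriv x Y D $ k) (at s)"
proof -
  define L where "L t = Y + (t - s) *\<^sub>R D" for t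
  define q where "q t = - (transpose (mp_inverse Y) *v (transpose D *v mp_coord x (L t)))
     + (mat 1 - Y ** mp_inverse Y) *v (D *v (mp_inverse (L t) *v mp_coord x (L t)))
     + transpose (mp_inverse Y) *v (mp_inverse Y *v (D *v ((mat 1 - mp_inverse (L t) ** L t) *v x)))" for t
  have Ls: "L s = Y" by (simp add: L_def)
  have "(L \<longlongrightarrow> Y + (s - s) *\<^sub>R D) (at s)"
    unfolding L_def by (intro tendsto_intros)
  then have L: "(L \<longlongrightarrow> Y) (at s)" by simp
  then have B: "((\<lambda>t. mp_inverse (L t)) \<longlongrightarrow> mp_inverse Y) (at s)"
    by (rule isCont_tendsto_compose[OF isCont_mp_inverse[OF assms]])
  then have v: "((\<lambda>t. mp_coord x (L t)) \<longlongrightarrow> mp_coord x Y) (at s)"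
    unfolding mp_coord_def by (intro tendsto_matrix_vector_mult tendsto_transpose tendsto_const)
  have q: "(q \<longlongrightarrow> mp_coord_deriv x Y D) (at s)"
    unfolding q_def mp_coord_deriv_def
    by (intro tendsto_add tendsto_minus tendsto_diff tendsto_matrix_vector_mult tendsto_matrix_matrix_mult tendsto_const L B v)
  have neq: "\<forall>\<^sub>F t in at s. t \<noteq> s" by (simp add: eventually_at_filter)
  have "\<forall>\<^sub>F t in at s. q t $ k = (mp_coord x (L t) $ k - mp_coord x (L s) $ k) / (t - s)"
    using eventually_full_rank_line[OF assms, where D=D and s=s] neq
  proof eventually_elim
    case (elim t)
    have "mp_coord x (L t) - mp_coord x Y = (t - s) *\<^sub>R q t"
      unfolding q_def by (rule mp_coord_difference[OF assms]) (use elim in \<open>simp_all add: L_def\<close>)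
    from arg_cong[OF this, of "\<lambda>u. u $ k"] show ?case
      using elim by (simp add: Ls)
  qed
  with tendsto_vec_nth[OF q, of k] have
    "((\<lambda>t. (mp_coord x (L t) $ k - mp_coord x (L s) $ k) / (t - s)) \<longlongrightarrow> mp_coord_deriv x Y D $ k) (at s)"
    by (rule Lim_transform_eventually)
  then show ?thesis
    by (simp add: has_field_derivative_iff L_def)
qed

text \<open>Changing the entry \<open>(i, j)\<close> of \<open>Z\<close> moves \<open>Z ** A\<close> in the direction \<open>row_matrix i (A $ j)\<close>.\<close>

definition row_matrix :: "'n \<Rightarrow> real^'p \<Rightarrow> real^'p^'n" where
  "row_matrix i a = (\<chi> k. if k = i then a else 0)"

lemma row_matrix_mult:
  "row_matrix i a *v u = (a \<bullet> u) *\<^sub>R axis i 1" "transpose (row_matrix i a) *v w = (w $ i) *\<^sub>R a"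
proof -
  have "(if k = i then a else 0) \<bullet> u = (if k = i then a \<bullet> u else 0)" for k by simp
  then show "row_matrix i a *v u = (a \<bullet> u) *\<^sub>R axis i 1"
    by (simp add: vec_eq_iff matrix_vector_mul_component row_matrix_def axis_def)
  have "(if k = i then a else 0) $ l * w $ k = (if k = i then a $ l * w $ i else 0)" for k l by simp
  then show "transpose (row_matrix i a) *v w = (w $ i) *\<^sub>R a"
    by (simp add: vec_eq_iff matrix_vector_mult_def transpose_def row_matrix_def)
qed

lemma set_entry_mult:
  "set_entry Z i j t ** A = Z ** A + (t - Z $ i $ j) *\<^sub>R row_matrix i (A $ j)"
proof -
  have "set_entry Z i j t $ k $ m * A $ m $ l = Z $ k $ m * A $ m $ l
     + (if m = j then (if k = i then (t - Z $ i $ j) * A $ j $ l else 0) else 0)" for k l m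
    by (auto simp: set_entry_def algebra_simps)
  then show ?thesis
    by (simp add: vec_eq_iff matrix_matrix_mult_def row_matrix_def sum.distrib)
qed

lemma ratio_deriv:
  fixes r :: "real \<Rightarrow> real"
  assumes "r differentiable (at s)" "s \<noteq> 0"
  shows "((\<lambda>s. (r s)\<^sup>2 / s\<^sup>2) has_real_derivative 2 * r s * deriv r s / s\<^sup>2 - 2 * (r s)\<^sup>2 / s ^ 3) (at s)"
proof -
  have r: "(r has_real_derivative deriv r s) (at s)"
    using assms(1) by (simp add: DERIV_deriv_iff_real_differentiable)
  show ?thesis
    by (rule derivative_eq_intros r refl)+
      (use assms(2) in \<open>simp_all add: field_simps power2_eq_square power3_eq_cube\<close>)
qed

text \<open>The product rule for \<open>\<phi>(F) v\<^sub>i (v\<^sup>T Z)\<^sub>j\<close> with \<open>\<phi>(s) = (r s)\<^sup>2 / s\<^sup>2\<close>; the rank-one formula holds along the whole line near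
  the point because full rank is an open condition.\<close>

lemma has_derivative_entry:
  fixes Z :: "real^'p^'n" and A :: "real^'p^'p" and x :: "real^'p"
  assumes sym: "transpose A = A" and inv: "A ** matrix_inv A = mat 1" and full: "full_rank (Z ** A)"
    and r: "\<And>s. r differentiable (at s)"
  defines "v \<equiv> mp_coord x (Z ** A)"
  defines "F \<equiv> v \<bullet> v"
  assumes F: "F \<noteq> 0"
  defines "dv \<equiv> \<lambda>i j. mp_coord_deriv x (Z ** A) (row_matrix i (A $ j))"
  shows "((\<lambda>t. (set_entry Z i j t ** H_mat r A (set_entry Z i j t) x) $ i $ j) has_real_derivative
    (2 * r F * deriv r F / F\<^sup>2 - 2 * (r F)\<^sup>2 / F ^ 3) * (2 * (v \<bullet> dv i j)) * v $ i * (\<Sum>k\<in>UNIV. Z $ k $ j * v $ k)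
    + (r F)\<^sup>2 / F\<^sup>2 * dv i j $ i * (\<Sum>k\<in>UNIV. Z $ k $ j * v $ k)
    + (r F)\<^sup>2 / F\<^sup>2 * v $ i * (v $ i + (\<Sum>k\<in>UNIV. Z $ k $ j * dv i j $ k))) (at (Z $ i $ j))"
proof -
  define s where "s = Z $ i $ j"
  define L where "L t = Z ** A + (t - s) *\<^sub>R row_matrix i (A $ j)" for t
  define u where "u t = mp_coord x (L t)" for t
  have us: "u s = v" by (simp add: u_def L_def v_def)
  have Zs: "set_entry Z i j s = Z"
    by (simp add: set_entry_def s_def vec_eq_iff)
  have u: "((\<lambda>t. u t $ k) has_real_derivative dv i j $ k) (at s)" for k
    unfolding u_def L_def dv_def by (rule has_derivative_mp_coord[OF full])
  have uu: "((\<lambda>t. u t \<bullet> u t) has_real_derivative 2 * (v \<bullet> dv i j)) (at s)"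
  proof -
    have "((\<lambda>t. \<Sum>k\<in>UNIV. u t $ k * u t $ k) has_real_derivative
        (\<Sum>k\<in>UNIV. dv i j $ k * u s $ k + dv i j $ k * u s $ k)) (at s)"
      by (rule DERIV_sum, rule DERIV_mult[OF u u])
    then show ?thesis
      by (simp add: inner_vec_def us sum.distrib mult.commute sum_distrib_left)
  qed
  have "((\<lambda>s. (r s)\<^sup>2 / s\<^sup>2) has_real_derivative 2 * r F * deriv r F / F\<^sup>2 - 2 * (r F)\<^sup>2 / F ^ 3) (at (u s \<bullet> u s))"
    using ratio_deriv[OF r F] by (simp add: us F_def)
  from DERIV_chain2[OF this uu]
  have \<phi>: "((\<lambda>t. (r (u t \<bullet> u t))\<^sup>2 / (u t \<bullet> u t)\<^sup>2) has_real_derivative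
      (2 * r F * deriv r F / F\<^sup>2 - 2 * (r F)\<^sup>2 / F ^ 3) * (2 * (v \<bullet> dv i j))) (at s)" .
  have e: "set_entry Z i j t $ k $ j * u t $ k = Z $ k $ j * u t $ k + (if k = i then (t - s) * u t $ i else 0)" for k t
    by (auto simp: set_entry_def s_def algebra_simps)
  have q: "((\<lambda>t. \<Sum>k\<in>UNIV. set_entry Z i j t $ k $ j * u t $ k) has_real_derivative
      v $ i + (\<Sum>k\<in>UNIV. Z $ k $ j * dv i j $ k)) (at s)"
  proof -
    have a: "((\<lambda>t. \<Sum>k\<in>UNIV. Z $ k $ j * u t $ k) has_real_derivative (\<Sum>k\<in>UNIV. Z $ k $ j * dv i j $ k)) (at s)"
      by (rule DERIV_sum, rule DERIV_cmult, rule u)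
    have "((\<lambda>t. t - s) has_real_derivative 1) (at s)"
      by (auto intro!: derivative_eq_intros)
    from DERIV_mult[OF this u[of i]] have "((\<lambda>t. (t - s) * u t $ i) has_real_derivative v $ i) (at s)"
      by (simp add: us)
    from DERIV_add[OF this a] show ?thesis
      unfolding e sum.distrib by (simp add: add.commute)
  qed
  have D: "((\<lambda>t. (r (u t \<bullet> u t))\<^sup>2 / (u t \<bullet> u t)\<^sup>2 * u t $ i * (\<Sum>k\<in>UNIV. set_entry Z i j t $ k $ j * u t $ k)) has_real_derivative
    (2 * r F * deriv r F / F\<^sup>2 - 2 * (r F)\<^sup>2 / F ^ 3) * (2 * (v \<bullet> dv i j)) * v $ i * (\<Sum>k\<in>UNIV. Z $ k $ j * v $ k)
    + (r F)\<^sup>2 / F\<^sup>2 * dv i j $ i * (\<Sum>k\<in>UNIV. Z $ k $ j * v $ k)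
    + (r F)\<^sup>2 / F\<^sup>2 * v $ i * (v $ i + (\<Sum>k\<in>UNIV. Z $ k $ j * dv i j $ k))) (at s)"
    by (rule DERIV_cong[OF DERIV_mult[OF DERIV_mult[OF \<phi> u] q]]) (simp add: us Zs F_def algebra_simps)
  have "\<forall>\<^sub>F t in at s. full_rank (L t)"
    unfolding L_def by (rule eventually_full_rank_line[OF full])
  then have "\<forall>\<^sub>F t in nhds s. full_rank (L t)"
    using full by (simp add: eventually_nhds_conv_at L_def)
  then have "\<forall>\<^sub>F t in nhds s. (set_entry Z i j t ** H_mat r A (set_entry Z i j t) x) $ i $ j
      = (r (u t \<bullet> u t))\<^sup>2 / (u t \<bullet> u t)\<^sup>2 * u t $ i * (\<Sum>k\<in>UNIV. set_entry Z i j t $ k $ j * u t $ k)"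
  proof eventually_elim
    case (elim t)
    have L: "set_entry Z i j t ** A = L t" by (simp add: L_def set_entry_mult s_def)
    show ?case using mult_H_mat_entry[OF sym inv, of "set_entry Z i j t" r x i j] elim by (simp add: L u_def)
  qed
  from DERIV_cong_ev[OF refl this refl] D show ?thesis by (simp add: s_def)
qed

lemma matrix_vector_axis_component: "(M *v axis i 1) $ k = M $ k $ i" for M :: "real^'b^'a"
  by (simp add: matrix_vector_mult_basis column_def)

text \<open>Every sum over \<open>j\<close> is evaluated by the contraction \<open>\<Sum>\<^sub>j (a\<^sub>j \<bullet> u) (z\<^sub>j \<bullet> y) = (Y u) \<bullet> y\<close>, where \<open>a\<^sub>j\<close> are the rows of
  \<open>A\<close> and \<open>z\<^sub>j\<close> the columns of \<open>Z\<close>. With \<open>u = B v\<close> it gives \<open>v \<bullet> y\<close>, and with \<open>u = w = (1 - B Y) x\<close> it gives zero,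
  which removes the third part of the derivative of \<open>v\<close>. The second part carries the projection \<open>Q = 1 - Y B\<close>, which
  annihilates \<open>v\<close> and the columns of \<open>Z\<close>, so that it contributes only through the trace of \<open>Q\<close>.\<close>

lemma divergence_sum:
  fixes Z :: "real^'p^'n" and A :: "real^'p^'p" and x :: "real^'p" and \<phi> \<phi>' :: real
  assumes inv: "A ** matrix_inv A = mat 1" and full: "full_rank (Z ** A)"
  defines "v \<equiv> mp_coord x (Z ** A)"
  defines "F \<equiv> v \<bullet> v"
  defines "dv \<equiv> \<lambda>i j. mp_coord_deriv x (Z ** A) (row_matrix i (A $ j))"
  shows "(\<Sum>i\<in>UNIV. \<Sum>j\<in>UNIV.
      \<phi>' * (2 * (v \<bullet> dv i j)) * v $ i * (\<Sum>k\<in>UNIV. Z $ k $ j * v $ k)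
    + \<phi> * dv i j $ i * (\<Sum>k\<in>UNIV. Z $ k $ j * v $ k)
    + \<phi> * v $ i * (v $ i + (\<Sum>k\<in>UNIV. Z $ k $ j * dv i j $ k)))
    = - 2 * \<phi>' * F\<^sup>2 + \<phi> * F * (real CARD('n) + real CARD('p) - 1 - 2 * trace (mp_inverse (Z ** A) ** (Z ** A)))"
proof -
  define Y where "Y = Z ** A"
  define B where "B = mp_inverse Y"
  define w where "w = (mat 1 - B ** Y) *v x"
  define Q where "Q = mat 1 - Y ** B"
  define z where "z j = transpose Z $ j" for j
  have full': "full_rank Y" using full by (simp add: Y_def)
  note f = mp_inverse_projection_facts[OF full_rank_mp_inverse(1)[OF full'], folded B_def]
  have v: "v = transpose B *v x" by (simp add: v_def mp_coord_def B_def Y_def)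
  have YBv: "Y *v (B *v v) = v"
    by (simp only: v matrix_vector_mul_assoc matrix_mul_assoc f)
  have Yw: "Y *v w = 0"
    by (simp only: w_def matrix_vector_mul_assoc matrix_matrix_mult_distribs matrix_mul_assoc f matrix_mul_rid diff_self matrix_vector_mult_0)
  have Qt: "transpose Q = Q" by (simp add: Q_def transpose_distribs f)
  have Qv: "Q *v v = 0"
    by (simp only: Q_def matrix_vector_mult_diff_rdistrib matrix_vector_mul_assoc[symmetric] YBv matrix_vector_mul_lid diff_self)
  have "Q ** Y = 0"
    by (simp only: Q_def matrix_matrix_mult_distribs f matrix_mul_lid diff_self)
  then have "Q ** (Z ** (A ** matrix_inv A)) = 0"
    by (simp add: Y_def matrix_mul_assoc)
  then have QZ: "Q ** Z = 0" by (simp add: inv)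
  have Qz: "Q *v z j = 0" for j
  proof -
    have "(Q *v z j) $ k = (Q ** Z) $ k $ j" for k
      by (simp add: matrix_vector_mult_def matrix_matrix_mult_def z_def transpose_def)
    then show ?thesis by (simp add: QZ vec_eq_iff)
  qed
  have zk: "(\<Sum>k\<in>UNIV. Z $ k $ j * y $ k) = z j \<bullet> y" for j y
    by (simp add: z_def transpose_def inner_vec_def)
  have dv: "dv i j = - (v $ i *\<^sub>R (transpose B *v (A $ j))) + (A $ j \<bullet> (B *v v)) *\<^sub>R (Q *v axis i 1)
      + (A $ j \<bullet> w) *\<^sub>R (transpose B *v (B *v axis i 1))" for i j
    unfolding dv_def mp_coord_deriv_def row_matrix_mult Y_def[symmetric] B_def[symmetric] Q_def[symmetric] w_def[symmetric]
    by (simp add: v_def Y_def[symmetric] row_matrix_mult matrix_vector_mult_scaleR)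
  have contract: "(\<Sum>j\<in>UNIV. (A $ j \<bullet> u) * (z j \<bullet> y)) = (Y *v u) \<bullet> y" for u y
  proof -
    have "(\<Sum>j\<in>UNIV. (A $ j \<bullet> u) * (z j \<bullet> y)) = (A *v u) \<bullet> (transpose Z *v y)"
      by (simp add: inner_vec_def[of "A *v u"] matrix_vector_mul_component z_def)
    also have "\<dots> = (Y *v u) \<bullet> y"
      by (simp add: Y_def inner_transpose_mult[of "A *v u"] matrix_vector_mul_assoc)
    finally show ?thesis .
  qed
  have Bt: "y \<bullet> (transpose B *v a) = (B *v y) \<bullet> a" for y a
    by (simp add: inner_transpose_mult[of y])
  have vdv: "v \<bullet> dv i j = - v $ i * (A $ j \<bullet> (B *v v)) + (A $ j \<bullet> w) * (transpose B *v (B *v v)) $ i" for i j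
  proof -
    have "v \<bullet> (Q *v axis i 1) = 0"
      by (simp add: inner_transpose_mult[of v] Qt Qv)
    moreover have "v \<bullet> (transpose B *v (B *v axis i 1)) = (transpose B *v (B *v v)) $ i"
      by (simp add: Bt inner_transpose_mult[of "B *v v"] inner_axis)
    ultimately show ?thesis
      by (simp add: dv inner_add_right inner_diff_right Bt inner_commute)
  qed
  have S1: "(\<Sum>j\<in>UNIV. (v \<bullet> dv i j) * (z j \<bullet> v)) = - v $ i * F" for i
  proof -
    have "(\<Sum>j\<in>UNIV. (v \<bullet> dv i j) * (z j \<bullet> v)) = - v $ i * (\<Sum>j\<in>UNIV. (A $ j \<bullet> (B *v v)) * (z j \<bullet> v))
      + (transpose B *v (B *v v)) $ i * (\<Sum>j\<in>UNIV. (A $ j \<bullet> w) * (z j \<bullet> v))"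
      by (simp add: vdv sum_distrib_left sum.distrib sum_subtractf sum_negf algebra_simps)
    then show ?thesis by (simp add: contract YBv Yw F_def)
  qed
  have S2: "(\<Sum>j\<in>UNIV. dv i j $ i * (z j \<bullet> v)) = - (v $ i)\<^sup>2 + Q $ i $ i * F" for i
  proof -
    have c: "(transpose B *v (A $ j)) $ i = A $ j \<bullet> (B *v axis i 1)" for j
      by (simp add: inner_transpose_mult[of "A $ j"] inner_axis)
    have "(\<Sum>j\<in>UNIV. dv i j $ i * (z j \<bullet> v)) = - v $ i * (\<Sum>j\<in>UNIV. (A $ j \<bullet> (B *v axis i 1)) * (z j \<bullet> v))
      + Q $ i $ i * (\<Sum>j\<in>UNIV. (A $ j \<bullet> (B *v v)) * (z j \<bullet> v))
      + (transpose B *v (B *v axis i 1)) $ i * (\<Sum>j\<in>UNIV. (A $ j \<bullet> w) * (z j \<bullet> v))"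
      by (simp add: dv c matrix_vector_axis_component sum_distrib_left sum.distrib sum_subtractf sum_negf algebra_simps)
    moreover have "(Y *v (B *v axis i 1)) \<bullet> v = v $ i"
    proof -
      have "(Y *v (B *v axis i 1)) \<bullet> v = v \<bullet> ((Y ** B) *v axis i 1)"
        by (simp add: matrix_vector_mul_assoc inner_commute)
      also have "\<dots> = ((Y ** B) *v v) \<bullet> axis i 1"
        by (simp only: inner_transpose_mult[of v] f)
      finally show ?thesis by (simp add: matrix_vector_mul_assoc[symmetric] YBv inner_axis)
    qed
    ultimately show ?thesis by (simp add: contract YBv Yw F_def power2_eq_square)
  qed
  have S3: "(\<Sum>j\<in>UNIV. z j \<bullet> dv i j) = - v $ i * trace (B ** Y)" for i
  proof -
    have c: "z j \<bullet> dv i j = - v $ i * (A ** (B ** Z)) $ j $ j + (A $ j \<bullet> w) * (z j \<bullet> (transpose B *v (B *v axis i 1)))" for j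
    proof -
      have "z j \<bullet> (Q *v axis i 1) = 0" by (simp add: inner_transpose_mult[of "z j"] Qt Qz)
      moreover have "(B *v z j) \<bullet> (A $ j) = (A ** (B ** Z)) $ j $ j"
      proof -
        have "(B *v z j) $ k = (B ** Z) $ k $ j" for k
          by (simp add: matrix_vector_mult_def matrix_matrix_mult_def z_def transpose_def)
        then show ?thesis by (simp add: matrix_matrix_mult_def[of A] inner_vec_def mult.commute)
      qed
      ultimately show ?thesis by (simp add: dv inner_add_right inner_diff_right Bt)
    qed
    have "(\<Sum>j\<in>UNIV. z j \<bullet> dv i j) = - v $ i * trace (A ** (B ** Z))
       + (\<Sum>j\<in>UNIV. (A $ j \<bullet> w) * (z j \<bullet> (transpose B *v (B *v axis i 1))))"
      by (simp add: c trace_def sum_distrib_left sum.distrib sum_subtractf sum_negf)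
    also have "trace (A ** (B ** Z)) = trace (B ** Y)"
      using trace_mul_sym[of A "B ** Z"] by (simp only: Y_def matrix_mul_assoc)
    finally show ?thesis by (simp add: contract Yw)
  qed
  have FF: "(\<Sum>i\<in>UNIV. (v $ i)\<^sup>2) = F" by (simp add: F_def inner_vec_def power2_eq_square)
  have trQ: "(\<Sum>i\<in>UNIV. Q $ i $ i) = CARD('n) - trace (B ** Y)"
  proof -
    have "trace Q = CARD('n) - trace (B ** Y)"
      by (simp add: Q_def trace_sub trace_I trace_mul_sym[of Y B])
    then show ?thesis by (simp add: trace_def)
  qed
  have row: "(\<Sum>j\<in>UNIV.
      \<phi>' * (2 * (v \<bullet> dv i j)) * v $ i * (z j \<bullet> v) + \<phi> * dv i j $ i * (z j \<bullet> v) + \<phi> * v $ i * (v $ i + z j \<bullet> dv i j))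
    = - 2 * \<phi>' * F * (v $ i)\<^sup>2 + \<phi> * (- (v $ i)\<^sup>2 + Q $ i $ i * F) + \<phi> * (CARD('p) - trace (B ** Y)) * (v $ i)\<^sup>2" for i
  proof -
    have "(\<Sum>j\<in>UNIV.
      \<phi>' * (2 * (v \<bullet> dv i j)) * v $ i * (z j \<bullet> v) + \<phi> * dv i j $ i * (z j \<bullet> v) + \<phi> * v $ i * (v $ i + z j \<bullet> dv i j))
     = 2 * \<phi>' * v $ i * (\<Sum>j\<in>UNIV. (v \<bullet> dv i j) * (z j \<bullet> v)) + \<phi> * (\<Sum>j\<in>UNIV. dv i j $ i * (z j \<bullet> v))
       + (\<phi> * v $ i * v $ i * CARD('p) + \<phi> * v $ i * (\<Sum>j\<in>UNIV. z j \<bullet> dv i j))"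
      by (simp add: sum.distrib sum_distrib_left algebra_simps)
    also have "\<dots> = - 2 * \<phi>' * F * (v $ i)\<^sup>2 + \<phi> * (- (v $ i)\<^sup>2 + Q $ i $ i * F) + \<phi> * (CARD('p) - trace (B ** Y)) * (v $ i)\<^sup>2"
      unfolding S1 S2 S3 by (simp add: algebra_simps power2_eq_square)
    finally show ?thesis .
  qed
  have "(\<Sum>i\<in>UNIV. \<Sum>j\<in>UNIV.
      \<phi>' * (2 * (v \<bullet> dv i j)) * v $ i * (\<Sum>k\<in>UNIV. Z $ k $ j * v $ k)
    + \<phi> * dv i j $ i * (\<Sum>k\<in>UNIV. Z $ k $ j * v $ k)
    + \<phi> * v $ i * (v $ i + (\<Sum>k\<in>UNIV. Z $ k $ j * dv i j $ k)))
    = - 2 * \<phi>' * F * (\<Sum>i\<in>UNIV. (v $ i)\<^sup>2) + \<phi> * (- (\<Sum>i\<in>UNIV. (v $ i)\<^sup>2) + (\<Sum>i\<in>UNIV. Q $ i $ i) * F)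
      + \<phi> * (CARD('p) - trace (B ** Y)) * (\<Sum>i\<in>UNIV. (v $ i)\<^sup>2)"
    unfolding zk row
    by (simp only: sum.distrib sum_distrib_left[symmetric] sum_distrib_right[symmetric] sum_negf)
  also have "\<dots> = - 2 * \<phi>' * F\<^sup>2 + \<phi> * F * (real CARD('n) + real CARD('p) - 1 - 2 * trace (B ** Y))"
    unfolding FF trQ by (simp add: algebra_simps power2_eq_square)
  finally show ?thesis by (simp add: B_def Y_def)
qed

text \<open>With \<open>\<phi>(s) = (r s)\<^sup>2 / s\<^sup>2\<close> one has \<open>- 2 \<phi>'(F) F\<^sup>2 = - 4 r(F) r'(F) + 4 (r F)\<^sup>2 / F\<close>, so the factor
  \<open>F\<^sup>2\<close> tames the singularity of \<open>\<phi>'\<close> and only \<open>1 / F\<close> has to be integrated.\<close>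

lemma matrix_div_formula:
  fixes Z :: "real^'p^'n" and A :: "real^'p^'p" and x :: "real^'p"
  assumes sym: "transpose A = A" and inv: "A ** matrix_inv A = mat 1" and full: "full_rank (Z ** A)"
    and r: "\<And>s. r differentiable (at s)"
  defines "F \<equiv> mp_coord x (Z ** A) \<bullet> mp_coord x (Z ** A)"
  assumes F: "F \<noteq> 0"
  shows "diag_partials_exist (\<lambda>Z. Z ** H_mat r A Z x) Z"
    and "matrix_div (\<lambda>Z. Z ** H_mat r A Z x) Z
      = - 4 * r F * deriv r F + (r F)\<^sup>2 / F * (real CARD('n) + real CARD('p) + 3 - 2 * trace (mp_inverse (Z ** A) ** (Z ** A)))"
proof -
  note D = has_derivative_entry[OF sym inv full r F[unfolded F_def], folded F_def]
  show "diag_partials_exist (\<lambda>Z. Z ** H_mat r A Z x) Z"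
    unfolding diag_partials_exist_def using D field_differentiable_def by blast
  show "matrix_div (\<lambda>Z. Z ** H_mat r A Z x) Z
      = - 4 * r F * deriv r F + (r F)\<^sup>2 / F * (real CARD('n) + real CARD('p) + 3 - 2 * trace (mp_inverse (Z ** A) ** (Z ** A)))"
    unfolding matrix_div_def DERIV_imp_deriv[OF D] divergence_sum[OF inv full, where x=x, folded F_def]
    using F by (simp add: field_simps power2_eq_square power3_eq_cube)
qed

section \<open>Rotation invariance of Lebesgue measure\<close>

lemma nn_integral_lborel_translate:
  fixes h :: "'a::euclidean_space \<Rightarrow> ennreal"
  assumes [measurable]: "h \<in> borel_measurable borel"
  shows "(\<integral>\<^sup>+y. h (y + c) \<partial>lborel) = (\<integral>\<^sup>+y. h y \<partial>lborel)"
proof -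
  have "(\<integral>\<^sup>+y. h y \<partial>lborel) = (\<integral>\<^sup>+y. h y \<partial>distr lborel borel ((+) c))"
    by (simp add: lborel_distr_plus)
  also have "\<dots> = (\<integral>\<^sup>+y. h (c + y) \<partial>lborel)"
    by (subst nn_integral_distr) auto
  finally show ?thesis by (simp add: add.commute)
qed

text \<open>The usual uniqueness argument for translation-invariant measures. Multiply by the volume of the unit ball, written as
  the integral of its indicator \<open>U\<close>, and shift first \<open>y\<close> by \<open>f x\<close> and then \<open>x\<close> by the preimage of \<open>y\<close>. This moves
  \<open>f\<close> from the argument of \<open>h\<close> to that of \<open>U\<close>, where it is harmless because the ball is invariant under \<open>f\<close>.\<close>

lemma nn_integral_lborel_orthogonal_transformation:
  fixes f :: "'a::euclidean_space \<Rightarrow> 'a"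
  assumes f: "orthogonal_transformation f" and h [measurable]: "h \<in> borel_measurable borel"
  shows "(\<integral>\<^sup>+x. h (f x) \<partial>lborel) = (\<integral>\<^sup>+x. h x \<partial>lborel)"
proof -
  define U where "U = (\<lambda>x :: 'a. indicator (ball 0 1) x :: ennreal)"
  have [measurable]: "U \<in> borel_measurable borel" unfolding U_def by (rule borel_measurable_indicator) simp
  have "linear f" and norm_f: "\<And>x. norm (f x) = norm x"
    using f by (auto simp: orthogonal_transformation)
  have [measurable]: "f \<in> borel_measurable borel"
    using \<open>linear f\<close> by (intro borel_measurable_continuous_onI linear_continuous_on linear_conv_bounded_linear[THEN iffD1])
  define g where "g = inv f"
  have fg: "f (g y) = y" for y
    using orthogonal_transformation_surj[OF f] by (simp add: g_def surj_f_inv_f)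
  have f_add: "f (x + g y) = f x + y" for x y
    using \<open>linear f\<close> by (simp add: linear_add fg)
  have Uf: "U (- f x) = U x" for x by (simp add: U_def norm_f indicator_def)
  have U_pos: "(\<integral>\<^sup>+y. U y \<partial>lborel) \<noteq> 0" "(\<integral>\<^sup>+y. U y \<partial>lborel) \<noteq> \<infinity>"
  proof -
    have "(\<integral>\<^sup>+y. U y \<partial>lborel) = emeasure lborel (ball (0 :: 'a) 1)"
      by (simp add: U_def)
    moreover have "emeasure lborel (ball (0 :: 'a) 1) \<noteq> 0"
      using open_not_negligible[of "ball (0 :: 'a) 1"] null_sets_completionI[of "ball (0 :: 'a) 1" lborel]
      by (auto simp: negligible_iff_null_sets null_sets_def)
    moreover have "emeasure lborel (ball (0 :: 'a) 1) < \<infinity>"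
      by (rule emeasure_bounded_finite) simp
    ultimately show "(\<integral>\<^sup>+y. U y \<partial>lborel) \<noteq> 0" "(\<integral>\<^sup>+y. U y \<partial>lborel) \<noteq> \<infinity>" by auto
  qed
  have "(\<integral>\<^sup>+x. h (f x) \<partial>lborel) * (\<integral>\<^sup>+y. U y \<partial>lborel)
      = (\<integral>\<^sup>+x. (\<integral>\<^sup>+y. h (f x) * U y \<partial>lborel) \<partial>lborel)"
    by (simp add: nn_integral_cmult nn_integral_multc)
  also have "\<dots> = (\<integral>\<^sup>+x. (\<integral>\<^sup>+y. h (f x) * U (y - f x) \<partial>lborel) \<partial>lborel)"
  proof (rule nn_integral_cong)
    fix x
    show "(\<integral>\<^sup>+y. h (f x) * U y \<partial>lborel) = (\<integral>\<^sup>+y. h (f x) * U (y - f x) \<partial>lborel)"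
      using nn_integral_lborel_translate[of "\<lambda>y. h (f x) * U y" "- f x"] by simp
  qed
  also have "\<dots> = (\<integral>\<^sup>+y. (\<integral>\<^sup>+x. h (f x) * U (y - f x) \<partial>lborel) \<partial>lborel)"
    by (rule lborel_pair.Fubini') measurable
  also have "\<dots> = (\<integral>\<^sup>+y. (\<integral>\<^sup>+x. h (f x + y) * U x \<partial>lborel) \<partial>lborel)"
  proof (rule nn_integral_cong)
    fix y
    have "(\<integral>\<^sup>+x. h (f x) * U (y - f x) \<partial>lborel) = (\<integral>\<^sup>+x. h (f (x + g y)) * U (y - f (x + g y)) \<partial>lborel)"
      by (rule nn_integral_lborel_translate[symmetric]) measurable
    then show "(\<integral>\<^sup>+x. h (f x) * U (y - f x) \<partial>lborel) = (\<integral>\<^sup>+x. h (f x + y) * U x \<partial>lborel)"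
      by (simp add: f_add Uf)
  qed
  also have "\<dots> = (\<integral>\<^sup>+x. (\<integral>\<^sup>+y. h (f x + y) * U x \<partial>lborel) \<partial>lborel)"
    by (rule lborel_pair.Fubini') measurable
  also have "\<dots> = (\<integral>\<^sup>+x. (\<integral>\<^sup>+y. h y \<partial>lborel) * U x \<partial>lborel)"
    by (intro nn_integral_cong)
      (simp add: nn_integral_multc nn_integral_lborel_translate[where h=h] add.commute[of "f _"])
  also have "\<dots> = (\<integral>\<^sup>+x. h x \<partial>lborel) * (\<integral>\<^sup>+y. U y \<partial>lborel)"
    by (simp add: nn_integral_cmult)
  finally show ?thesis
    using U_pos by (metis ennreal_mult_cancel_left mult.commute infinity_ennreal_def)
qed

section \<open>Inverse moments of Gaussian weights\<close>

definition gauss :: "real \<Rightarrow> 'a::euclidean_space \<Rightarrow> real" where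
  "gauss c x = exp (- c * (norm x)\<^sup>2)"

lemma gauss_pos: "0 < gauss c x"
  by (simp add: gauss_def)

lemma borel_measurable_gauss [measurable]: "gauss c \<in> borel_measurable borel"
  unfolding gauss_def[abs_def] by measurable

lemma norm_sq_Basis: "(norm x)\<^sup>2 = (\<Sum>b\<in>Basis. (x \<bullet> b)\<^sup>2)" for x :: "'a::euclidean_space"
  unfolding power2_norm_eq_inner by (subst euclidean_inner) (simp add: power2_eq_square)

lemma gauss_prod: "gauss c x = (\<Prod>b\<in>Basis. gauss c (x \<bullet> b))"
  by (simp add: gauss_def norm_sq_Basis exp_sum[symmetric] sum_distrib_left)

text \<open>The function \<open>\<bar>t\<bar> ^ (-2/3)\<close>, which is integrable at the origin; a product of three copies dominates the inverse square of the
  norm in three dimensions. The value \<open>\<infinity>\<close> at zero keeps that domination valid where the inverse square is infinite.\<close>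

definition spike :: "real \<Rightarrow> ennreal" where
  "spike t = (if t = 0 then \<infinity> else ennreal (\<bar>t\<bar> powr (- (2 / 3))))"

lemma borel_measurable_spike [measurable]: "spike \<in> borel_measurable borel"
  unfolding spike_def[abs_def] by measurable

lemma nn_integral_gauss_real:
  fixes a :: real
  assumes "0 < c"
  shows "(\<integral>\<^sup>+t. gauss c (t - a) \<partial>lborel) = ennreal (sqrt (pi / c))"
proof -
  define \<sigma> where "\<sigma> = sqrt (1 / (2 * c))"
  have \<sigma>: "0 < \<sigma>" "\<sigma>\<^sup>2 = 1 / (2 * c)" using assms by (auto simp: \<sigma>_def)
  have eq: "gauss c (t - a) = sqrt (pi / c) * normal_density a \<sigma> t" for t
    using assms by (simp add: gauss_def normal_density_def \<sigma> field_simps)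
  have "(\<integral>\<^sup>+t. normal_density a \<sigma> t \<partial>lborel) = 1"
    using prob_space.emeasure_space_1[OF prob_space_normal_density[OF \<sigma>(1), of a]]
    by (simp add: emeasure_density)
  then show ?thesis
    using assms by (simp add: eq ennreal_mult nn_integral_cmult)
qed

lemma nn_integral_spike_unit: "(\<integral>\<^sup>+t. spike t * indicator {-1..1} t \<partial>lborel) < \<infinity>"
proof -
  define h :: "real \<Rightarrow> real" where "h t = (if t \<in> {0..1} then t powr (- (2 / 3)) else 0)" for t
  have [measurable]: "h \<in> borel_measurable borel"
    unfolding h_def[abs_def] by measurable
  have "(\<lambda>t :: real. t powr (- (2 / 3))) integrable_on {0..1}"
    by (rule integrable_on_powr_from_0) auto
  then have "h integrable_on UNIV"
    unfolding h_def[abs_def] by (subst integrable_restrict_UNIV)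
  then obtain I where "(h has_integral I) UNIV" by (auto simp: integrable_on_def)
  then have h: "(\<integral>\<^sup>+t. h t \<partial>lborel) < \<infinity>"
    by (subst nn_integral_has_integral_lborel) (auto simp: h_def)
  have "(\<integral>\<^sup>+t. h (- t) \<partial>lborel) = (\<integral>\<^sup>+t. h t \<partial>distr lborel borel uminus)"
    by (subst nn_integral_distr) auto
  then have h': "(\<integral>\<^sup>+t. h (- t) \<partial>lborel) < \<infinity>"
    using h by (simp add: lborel_distr_uminus)
  have "AE t :: real in lborel. t \<notin> {0}"
    by (intro AE_not_in finite_imp_null_set_lborel) auto
  then have "AE t in lborel. spike t * indicator {-1..1} t \<le> ennreal (h t) + ennreal (h (- t))"
    by eventually_elim (auto simp: spike_def h_def indicator_def abs_if)
  then have "(\<integral>\<^sup>+t. spike t * indicator {-1..1} t \<partial>lborel) \<le> (\<integral>\<^sup>+t. ennreal (h t) + ennreal (h (- t)) \<partial>lborel)"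
    by (rule nn_integral_mono_AE)
  also have "\<dots> < \<infinity>"
    using h h' by (simp add: nn_integral_add)
  finally show ?thesis .
qed

lemma spike_le_one: "1 < \<bar>t\<bar> \<Longrightarrow> spike t \<le> 1"
  by (auto simp: spike_def ennreal_le_1 powr_minus inverse_le_1_iff intro!: ge_one_powr_ge_zero)

text \<open>The bound is uniform in the centre \<open>a\<close>: near the origin the Gaussian factor is at most one, and elsewhere the spike is.\<close>

lemma nn_integral_spike_gauss:
  assumes "0 < c"
  obtains K where "K < \<infinity>" and "\<And>a. (\<integral>\<^sup>+t. spike t * gauss c (t - a) \<partial>lborel) \<le> K"
proof
  define K where "K = (\<integral>\<^sup>+t. spike t * indicator {-1..1} t \<partial>lborel) + ennreal (sqrt (pi / c))"
  show "K < \<infinity>" using nn_integral_spike_unit by (simp add: K_def)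
  fix a
  have "spike t * gauss c (t - a) \<le> spike t * indicator {-1..1} t + gauss c (t - a)" for t
  proof (cases "\<bar>t\<bar> \<le> 1")
    case True
    have "gauss c (t - a) \<le> 1" using assms by (simp add: gauss_def)
    then have "spike t * gauss c (t - a) \<le> spike t * 1"
      by (intro mult_left_mono) (simp_all add: ennreal_le_1)
    with True show ?thesis by (simp add: indicator_def abs_le_iff add_increasing2)
  next
    case False
    then have "spike t * gauss c (t - a) \<le> 1 * ennreal (gauss c (t - a))"
      by (intro mult_right_mono spike_le_one) auto
    then show ?thesis by (simp add: add_increasing)
  qed
  then have "(\<integral>\<^sup>+t. spike t * gauss c (t - a) \<partial>lborel) \<le> (\<integral>\<^sup>+t. spike t * indicator {-1..1} t + gauss c (t - a) \<partial>lborel)"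
    by (intro nn_integral_mono)
  also have "\<dots> = K" using assms by (simp add: K_def nn_integral_add nn_integral_gauss_real)
  finally show "(\<integral>\<^sup>+t. spike t * gauss c (t - a) \<partial>lborel) \<le> K" .
qed

text \<open>Each of the three squares is at most their sum \<open>s\<close>, so \<open>s\<^sup>-\<^sup>1\<close>, split into three factors \<open>s ^ (-1/3)\<close>, is at most the
  product of the three spikes. This separates the variables.\<close>

lemma inverse_sum_squares_le_spikes:
  "inverse (ennreal (x\<^sup>2 + y\<^sup>2 + z\<^sup>2)) \<le> spike x * spike y * spike z"
proof (cases "x = 0 \<or> y = 0 \<or> z = 0")
  case True
  have "spike t \<noteq> 0" for t by (simp add: spike_def)
  with True have "spike x * spike y * spike z = \<infinity>"
    by (auto simp: spike_def ennreal_mult_eq_top_iff ennreal_top_mult ennreal_mult_top)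
  then show ?thesis by simp
next
  case False
  define s where "s = x\<^sup>2 + y\<^sup>2 + z\<^sup>2"
  have s: "0 < s" using False by (simp add: s_def add_pos_pos)
  have le: "x\<^sup>2 \<le> s" "y\<^sup>2 \<le> s" "z\<^sup>2 \<le> s" by (auto simp: s_def)
  have p: "s powr - (1 / 3) \<le> \<bar>t\<bar> powr - (2 / 3)" if "t \<noteq> 0" "t\<^sup>2 \<le> s" for t
  proof -
    have "t\<^sup>2 = \<bar>t\<bar> powr 2" by simp
    then have "\<bar>t\<bar> powr - (2 / 3) = (t\<^sup>2) powr - (1 / 3)"
      by (simp add: powr_powr del: powr_numeral)
    with that show ?thesis by (simp add: powr_mono2')
  qed
  have "inverse s = s powr (- (1 / 3) + - (1 / 3) + - (1 / 3))"
    using s by (simp add: powr_minus)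
  also have "\<dots> = s powr - (1 / 3) * s powr - (1 / 3) * s powr - (1 / 3)"
    by (simp only: powr_add)
  also have "\<dots> \<le> \<bar>x\<bar> powr - (2 / 3) * \<bar>y\<bar> powr - (2 / 3) * \<bar>z\<bar> powr - (2 / 3)"
    using False le by (intro mult_mono p) auto
  finally have "ennreal (inverse s) \<le> ennreal (\<bar>x\<bar> powr - (2 / 3) * \<bar>y\<bar> powr - (2 / 3) * \<bar>z\<bar> powr - (2 / 3))"
    by (rule ennreal_leI)
  also have "\<dots> = spike x * spike y * spike z"
    using False by (simp add: spike_def ennreal_mult)
  finally show ?thesis using inverse_ennreal[OF s] by (simp only: s_def)
qed

lemma inverse_ennreal_antimono: "x \<le> y \<Longrightarrow> inverse y \<le> inverse (x :: ennreal)"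
proof (cases "x = 0 \<or> y = \<infinity>")
  case False
  assume "x \<le> y"
  with False obtain a b where "x = ennreal a" "y = ennreal b" "0 < a" "a \<le> b"
    by (cases x; cases y) (auto simp: top_unique)
  then show ?thesis by (simp add: inverse_ennreal le_imp_inverse_le)
qed auto

text \<open>An orthonormal basis of \<open>V\<close> and one of its orthogonal complement together form an orthonormal basis of the whole space,
  onto which the standard basis can be rotated.\<close>

lemma orthogonal_transformation_basis_into_subspace:
  fixes V :: "'a::euclidean_space set"
  assumes V: "subspace V" and dim: "3 \<le> dim V"
  obtains f :: "'a \<Rightarrow> 'a" and b1 b2 b3 where "orthogonal_transformation f" "{b1, b2, b3} \<subseteq> Basis"
    "b1 \<noteq> b2" "b1 \<noteq> b3" "b2 \<noteq> b3" "f b1 \<in> V" "f b2 \<in> V" "f b3 \<in> V"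
proof -
  define W where "W = {y. \<forall>x\<in>V. orthogonal x y}"
  have W: "subspace W"
    unfolding W_def by (rule subspace_orthogonal_to_vectors)
  have dimW: "dim W + dim V = DIM('a)"
    using dim_subspace_orthogonal_to_vectors[OF V, of UNIV] by (simp add: W_def)
  obtain B where B: "B \<subseteq> V" "pairwise orthogonal B" "\<And>x. x \<in> B \<Longrightarrow> norm x = 1" "independent B" "card B = dim V"
    using orthonormal_basis_subspace[OF V] by metis
  obtain C where C: "C \<subseteq> W" "pairwise orthogonal C" "\<And>x. x \<in> C \<Longrightarrow> norm x = 1" "independent C" "card C = dim W"
    using orthonormal_basis_subspace[OF W] by metis
  have fin: "finite B" "finite C" using B C by (auto intro: independent_imp_finite)
  have BC: "orthogonal x y" if "x \<in> B" "y \<in> C" for x y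
    using that B(1) C(1) by (auto simp: W_def)
  have CB: "orthogonal y x" if "x \<in> B" "y \<in> C" for x y
    using BC[OF that] by (simp add: orthogonal_commute)
  have "B \<inter> C = {}"
    using BC B(3) by (fastforce simp: orthogonal_def)
  then have card: "card (B \<union> C) = DIM('a)"
    using fin B(5) C(5) dimW by (simp add: card_Un_disjoint)
  have orth: "x \<bullet> y = (if x = y then 1 else 0)" if "x \<in> B \<union> C" "y \<in> B \<union> C" for x y
  proof (cases "x = y")
    case True
    then show ?thesis using that B(3) C(3) by (auto simp: norm_eq_1)
  next
    case False
    then have "orthogonal x y"
      using that B(2) C(2) BC CB by (auto simp: pairwise_def)
    with False show ?thesis by (simp add: orthogonal_def)
  qed
  obtain \<beta> where \<beta>: "bij_betw \<beta> (Basis :: 'a set) (B \<union> C)"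
    using card fin bij_betw_iff_card[of "Basis :: 'a set" "B \<union> C"] by auto
  define f where "f x = (\<Sum>b\<in>Basis. (x \<bullet> b) *\<^sub>R \<beta> b)" for x :: 'a
  have \<beta>_orth: "\<beta> b \<bullet> \<beta> b' = (if b = b' then 1 else 0)" if "b \<in> Basis" "b' \<in> Basis" for b b'
    using orth[OF bij_betwE[OF \<beta>, rule_format, OF that(1)] bij_betwE[OF \<beta>, rule_format, OF that(2)]]
      inj_on_eq_iff[OF bij_betw_imp_inj_on[OF \<beta>] that] by simp
  have f_basis: "f b = \<beta> b" if "b \<in> Basis" for b
    using that by (simp add: f_def inner_Basis if_distrib[of "\<lambda>r. r *\<^sub>R _"] cong: if_cong)
  have "linear f"
    by (rule linearI) (simp_all add: f_def inner_add_left scaleR_add_left sum.distrib scaleR_sum_right)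
  moreover have "f x \<bullet> f y = x \<bullet> y" for x y
  proof -
    have "f x \<bullet> f y = (\<Sum>b\<in>Basis. \<Sum>b'\<in>Basis. (x \<bullet> b) * (y \<bullet> b') * (\<beta> b \<bullet> \<beta> b'))"
      by (subst sum.swap) (simp add: f_def inner_sum_left inner_sum_right sum_distrib_left mult_ac)
    also have "\<dots> = (\<Sum>b\<in>Basis. \<Sum>b'\<in>Basis. if b = b' then (x \<bullet> b) * (y \<bullet> b') else 0)"
      by (intro sum.cong refl) (simp add: \<beta>_orth)
    also have "\<dots> = x \<bullet> y"
      by (subst (3) euclidean_inner) simp
    finally show ?thesis .
  qed
  ultimately have f: "orthogonal_transformation f"
    by (simp add: orthogonal_transformation_def)
  obtain T where T: "T \<subseteq> B" "card T = 3"
    using obtain_subset_with_card_n[of 3 B] dim B(5) by metis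
  then obtain u1 u2 u3 where u: "T = {u1, u2, u3}" "u1 \<noteq> u2" "u1 \<noteq> u3" "u2 \<noteq> u3"
    unfolding card_3_iff by auto
  define g where "g = inv_into Basis \<beta>"
  have g: "g u \<in> Basis" "\<beta> (g u) = u" if "u \<in> B" for u
    using that \<beta> unfolding g_def bij_betw_def by (auto intro: inv_into_into f_inv_into_f)
  have uB: "u1 \<in> B" "u2 \<in> B" "u3 \<in> B" using T u by auto
  show ?thesis
  proof (rule that[OF f, of "g u1" "g u2" "g u3"])
    show "g u1 \<noteq> g u2" "g u1 \<noteq> g u3" "g u2 \<noteq> g u3" using u g(2) uB by metis+
    show "f (g u1) \<in> V" "f (g u2) \<in> V" "f (g u3) \<in> V" using g uB B(1) by (auto simp: f_basis)
  qed (use g uB in auto)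
qed

text \<open>The condition on \<open>P\<close> says that it preserves inner products with \<open>V\<close>, as the orthogonal projection onto a space containing \<open>V\<close> does.
  After a rotation taking three basis vectors into \<open>V\<close>, the squared norm of \<open>P x\<close> is at least the sum of three squared coordinates;
  the integrand is then dominated by a product of functions of single coordinates. Three dimensions are needed:
  in two, the inverse square is not locally integrable. The bound depends neither on \<open>V\<close> and \<open>P\<close> nor on the centre \<open>a\<close>,
  which matters because the projection is later random.\<close>

lemma nn_integral_inverse_projection_gauss:
  assumes c: "0 < c"
  shows "\<exists>K<\<infinity>. \<forall>(V :: 'a::euclidean_space set) P a. subspace V \<and> 3 \<le> dim V \<and> (\<forall>u\<in>V. \<forall>x. u \<bullet> P x = u \<bullet> x) \<longrightarrow>
      (\<integral>\<^sup>+x. inverse (ennreal ((norm (P x))\<^sup>2)) * gauss c (x - a) \<partial>lborel) \<le> K"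
proof -
  obtain K0 where K0: "K0 < \<infinity>" "\<And>a. (\<integral>\<^sup>+t. spike t * gauss c (t - a) \<partial>lborel) \<le> K0"
    using nn_integral_spike_gauss[OF c] by blast
  define K1 where "K1 = K0 + ennreal (sqrt (pi / c))"
  show ?thesis
  proof (intro exI[of _ "K1 ^ DIM('a)"] conjI allI impI)
    show "K1 ^ DIM('a) < \<infinity>"
      using K0(1) by (simp add: K1_def power_less_top_ennreal)
    fix V :: "'a set" and P a
    assume "subspace V \<and> 3 \<le> dim V \<and> (\<forall>u\<in>V. \<forall>x. u \<bullet> P x = u \<bullet> x)"
    then have V: "subspace V" "3 \<le> dim V" and P: "\<And>u x. u \<in> V \<Longrightarrow> u \<bullet> P x = u \<bullet> x" by auto
    obtain f :: "'a \<Rightarrow> 'a" and b1 b2 b3 where f: "orthogonal_transformation f" and b: "{b1, b2, b3} \<subseteq> Basis"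
      "b1 \<noteq> b2" "b1 \<noteq> b3" "b2 \<noteq> b3" "f b1 \<in> V" "f b2 \<in> V" "f b3 \<in> V"
      using orthogonal_transformation_basis_into_subspace[OF V] by metis
    define g where "g = inv f"
    have fg: "f (g y) = y" for y
      using orthogonal_transformation_surj[OF f] by (simp add: g_def surj_f_inv_f)
    have f_inner: "f x \<bullet> f y = x \<bullet> y" and f_diff: "f (x - y) = f x - f y" for x y
      using f by (auto simp: orthogonal_transformation_def linear_diff)
    have f_norm: "norm (f x) = norm x" for x
      using f by (rule orthogonal_transformation_norm)
    define H where "H x = spike (f b1 \<bullet> x) * spike (f b2 \<bullet> x) * spike (f b3 \<bullet> x) * ennreal (gauss c (x - a))" for x
    have [measurable]: "H \<in> borel_measurable borel" unfolding H_def by measurable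
    have "inverse (ennreal ((norm (P x))\<^sup>2)) * gauss c (x - a) \<le> H x" for x
    proof -
      have coord: "f b' \<bullet> x = g (P x) \<bullet> b'" if "f b' \<in> V" for b'
        using P[OF that, of x] f_inner[of b' "g (P x)"] by (simp add: fg inner_commute)
      have "(\<Sum>b'\<in>{b1, b2, b3}. (g (P x) \<bullet> b')\<^sup>2) \<le> (\<Sum>b'\<in>Basis. (g (P x) \<bullet> b')\<^sup>2)"
        using b by (intro sum_mono2) auto
      also have "\<dots> = (norm (P x))\<^sup>2"
        using f_norm[of "g (P x)"] unfolding fg norm_sq_Basis[symmetric] by simp
      finally have "(f b1 \<bullet> x)\<^sup>2 + (f b2 \<bullet> x)\<^sup>2 + (f b3 \<bullet> x)\<^sup>2 \<le> (norm (P x))\<^sup>2"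
        using b by (simp add: coord)
      then have "inverse (ennreal ((norm (P x))\<^sup>2)) \<le> inverse (ennreal ((f b1 \<bullet> x)\<^sup>2 + (f b2 \<bullet> x)\<^sup>2 + (f b3 \<bullet> x)\<^sup>2))"
        by (intro inverse_ennreal_antimono ennreal_leI)
      also have "\<dots> \<le> spike (f b1 \<bullet> x) * spike (f b2 \<bullet> x) * spike (f b3 \<bullet> x)"
        by (rule inverse_sum_squares_le_spikes)
      finally show ?thesis unfolding H_def by (rule mult_right_mono) simp
    qed
    then have "(\<integral>\<^sup>+x. inverse (ennreal ((norm (P x))\<^sup>2)) * gauss c (x - a) \<partial>lborel) \<le> (\<integral>\<^sup>+x. H x \<partial>lborel)"
      by (intro nn_integral_mono)
    also have "\<dots> = (\<integral>\<^sup>+x. H (f x) \<partial>lborel)"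
      by (rule nn_integral_lborel_orthogonal_transformation[OF f, symmetric]) measurable
    also have "\<dots> = (\<integral>\<^sup>+x. (\<Prod>b\<in>Basis. (if b \<in> {b1, b2, b3} then spike (x \<bullet> b) else 1) * gauss c (x \<bullet> b - g a \<bullet> b)) \<partial>lborel)"
    proof (rule nn_integral_cong)
      fix x
      have "gauss c (f x - a) = gauss c (x - g a)"
        using f_norm[of "x - g a"] by (simp add: gauss_def f_diff fg)
      also have "\<dots> = (\<Prod>b\<in>Basis. gauss c (x \<bullet> b - g a \<bullet> b))"
        by (subst gauss_prod) (simp add: inner_diff_left)
      finally have "ennreal (gauss c (f x - a)) = (\<Prod>b\<in>Basis. ennreal (gauss c (x \<bullet> b - g a \<bullet> b)))"
        by (simp add: prod_ennreal less_imp_le[OF gauss_pos])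
      moreover have "(\<Prod>b\<in>Basis. if b \<in> {b1, b2, b3} then spike (x \<bullet> b) else 1) = (\<Prod>b\<in>{b1, b2, b3}. spike (x \<bullet> b))"
        using b by (intro prod.mono_neutral_cong_right) auto
      ultimately show "H (f x) = (\<Prod>b\<in>Basis. (if b \<in> {b1, b2, b3} then spike (x \<bullet> b) else 1) * gauss c (x \<bullet> b - g a \<bullet> b))"
        using b by (simp add: H_def f_inner prod.distrib inner_commute mult.assoc)
    qed
    also have "\<dots> = (\<Prod>b\<in>Basis. \<integral>\<^sup>+t. (if b \<in> {b1, b2, b3} then spike t else 1) * gauss c (t - g a \<bullet> b) \<partial>lborel)"
      by (rule nn_integral_lborel_prod) auto
    also have "\<dots> \<le> (\<Prod>b\<in>(Basis :: 'a set). K1)"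
    proof (rule prod_mono_ennreal)
      fix b :: 'a
      show "(\<integral>\<^sup>+t. (if b \<in> {b1, b2, b3} then spike t else 1) * gauss c (t - g a \<bullet> b) \<partial>lborel) \<le> K1"
      proof (cases "b \<in> {b1, b2, b3}")
        case True
        then show ?thesis using K0(2)[of "g a \<bullet> b"] unfolding K1_def by (simp only: if_True) (simp add: add_increasing2)
      next
        case False
        then show ?thesis using nn_integral_gauss_real[OF c, of "g a \<bullet> b"] unfolding K1_def
          by (simp only: if_False) (simp add: add_increasing)
      qed
    qed
    also have "\<dots> = K1 ^ DIM('a)" by simp
    finally show "(\<integral>\<^sup>+x. inverse (ennreal ((norm (P x))\<^sup>2)) * gauss c (x - a) \<partial>lborel) \<le> K1 ^ DIM('a)" .
  qed
qed

text \<open>Half of the exponent absorbs the polynomial factor.\<close>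

lemma nn_integral_norm_sq_gauss:
  assumes c: "0 < c"
  shows "(\<integral>\<^sup>+(x :: 'a::euclidean_space). ennreal ((norm x)\<^sup>2) * gauss c x \<partial>lborel) < \<infinity>"
proof -
  have le: "(norm x)\<^sup>2 * gauss c x \<le> 2 / c * gauss (c / 2) x" for x :: 'a
  proof -
    have "c / 2 * (norm x)\<^sup>2 \<le> exp (c / 2 * (norm x)\<^sup>2)"
      using exp_ge_add_one_self[of "c / 2 * (norm x)\<^sup>2"] by linarith
    then have "c / 2 * (norm x)\<^sup>2 * gauss c x \<le> exp (c / 2 * (norm x)\<^sup>2) * gauss c x"
      by (intro mult_right_mono) (simp_all add: gauss_def)
    also have "\<dots> = gauss (c / 2) x"
      by (simp add: gauss_def exp_add[symmetric])
    finally show ?thesis using c by (simp add: field_simps)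
  qed
  have "(\<integral>\<^sup>+(x :: 'a). ennreal ((norm x)\<^sup>2) * gauss c x \<partial>lborel) \<le> (\<integral>\<^sup>+(x :: 'a). ennreal (2 / c) * gauss (c / 2) x \<partial>lborel)"
  proof (rule nn_integral_mono)
    fix x :: 'a
    have "ennreal ((norm x)\<^sup>2) * gauss c x = ennreal ((norm x)\<^sup>2 * gauss c x)"
      by (rule ennreal_mult[symmetric]) (simp_all add: less_imp_le[OF gauss_pos])
    also have "\<dots> \<le> ennreal (2 / c * gauss (c / 2) x)"
      by (rule ennreal_leI[OF le])
    also have "\<dots> = ennreal (2 / c) * gauss (c / 2) x"
      by (rule ennreal_mult) (use c in \<open>simp_all add: less_imp_le[OF gauss_pos]\<close>)
    finally show "ennreal ((norm x)\<^sup>2) * gauss c x \<le> ennreal (2 / c) * gauss (c / 2) x" .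
  qed
  also have "\<dots> = ennreal (2 / c) * (\<integral>\<^sup>+(x :: 'a). (\<Prod>b\<in>Basis. ennreal (gauss (c / 2) (x \<bullet> b))) \<partial>lborel)"
    by (subst nn_integral_cmult, simp, subst gauss_prod) (simp add: prod_ennreal less_imp_le[OF gauss_pos])
  also have "\<dots> = ennreal (2 / c) * (\<Prod>b\<in>(Basis :: 'a set). ennreal (sqrt (pi / (c / 2))))"
    using nn_integral_gauss_real[of "c / 2" 0] c by (subst nn_integral_lborel_prod) simp_all
  also have "\<dots> < \<infinity>"
    by (simp add: ennreal_mult_less_top power_less_top_ennreal)
  finally show ?thesis .
qed

section \<open>Almost every matrix has full rank\<close>

text \<open>Average the measure of the zero set over its translates along \<open>e\<close> and exchange the integrals: each line parallel to
  \<open>e\<close> meets the zero set in a null set.\<close>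

lemma AE_nonzero_of_finite_on_lines:
  fixes f :: "'a::euclidean_space \<Rightarrow> real"
  assumes [measurable]: "f \<in> borel_measurable borel"
    and fin: "\<And>y. finite {t. f (y + t *\<^sub>R e) = 0}"
  shows "AE y in lborel. f y \<noteq> 0"
proof -
  define I where "I = (\<lambda>y. indicator {0} (f y) :: ennreal)"
  have [measurable]: "I \<in> borel_measurable borel" by (simp add: I_def)
  have "(\<integral>\<^sup>+y. I y \<partial>lborel) = (\<integral>\<^sup>+(t::real). indicator {0..1} t * (\<integral>\<^sup>+y. I y \<partial>lborel) \<partial>lborel)"
    by (subst nn_integral_multc) auto
  also have "\<dots> = (\<integral>\<^sup>+(t::real). (\<integral>\<^sup>+y. indicator {0..1} t * I (y + t *\<^sub>R e) \<partial>lborel) \<partial>lborel)"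
    by (intro nn_integral_cong) (simp add: nn_integral_cmult nn_integral_lborel_translate)
  also have "\<dots> = (\<integral>\<^sup>+y. (\<integral>\<^sup>+(t::real). indicator {0..1} t * I (y + t *\<^sub>R e) \<partial>lborel) \<partial>lborel)"
    by (rule lborel_pair.Fubini'[symmetric]) measurable
  also have "\<dots> = (\<integral>\<^sup>+(y::'a). 0 \<partial>lborel)"
  proof (rule nn_integral_cong)
    fix y :: 'a
    have "AE t in lborel. t \<notin> {t. f (y + t *\<^sub>R e) = 0}"
      by (intro AE_not_in finite_imp_null_set_lborel fin)
    then have "AE t in lborel. indicator {0..1} t * I (y + t *\<^sub>R e) = 0"
      by eventually_elim (simp add: I_def)
    then show "(\<integral>\<^sup>+(t::real). indicator {0..1} t * I (y + t *\<^sub>R e) \<partial>lborel) = 0"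
      by (subst nn_integral_0_iff_AE) auto
  qed
  finally have "(\<integral>\<^sup>+y. I y \<partial>lborel) = 0" by simp
  then have "AE y in lborel. I y = 0"
    by (subst (asm) nn_integral_0_iff_AE) auto
  then show ?thesis by eventually_elim (auto simp: I_def)
qed

lemma real_polynomial_function_det:
  fixes F :: "real \<Rightarrow> real^'a^'a"
  assumes "\<And>i j. real_polynomial_function (\<lambda>t. F t $ i $ j)"
  shows "real_polynomial_function (\<lambda>t. det (F t))"
  unfolding det_def using assms
  by (intro real_polynomial_function_sum real_polynomial_function.intros(4) real_polynomial_function_prod) auto

lemma real_polynomial_function_finite_roots:
  assumes "real_polynomial_function (p :: real \<Rightarrow> real)" "p s \<noteq> 0"
  shows "finite {t. p t = 0}"
proof -
  from assms(1) obtain a n where p: "p = (\<lambda>x. \<Sum>i\<le>n. a i * x ^ i)"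
    unfolding real_polynomial_function_iff_sum by blast
  with assms(2) have "\<exists>i\<le>n. a i \<noteq> 0"
    by (auto intro: ccontr sum.neutral)
  then show ?thesis using polyfun_finite_roots[of a n] by (simp add: p)
qed

lemma det_gram_nonzero:
  fixes M :: "real^'b^'a"
  assumes "\<And>x. M *v x = 0 \<Longrightarrow> x = 0"
  shows "det (transpose M ** M) \<noteq> 0"
proof -
  have "x = 0" if "(transpose M ** M) *v x = 0" for x
  proof -
    have "(M *v x) \<bullet> (M *v x) = x \<bullet> ((transpose M ** M) *v x)"
      by (simp add: inner_transpose_mult[of x] matrix_vector_mul_assoc[symmetric] inner_commute)
    with that assms show ?thesis by simp
  qed
  then have "\<exists>N. N ** (transpose M ** M) = mat 1"
    by (simp add: matrix_left_invertible_ker)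
  then show ?thesis by (simp add: invertible_det_nz[symmetric] invertible_left_inverse)
qed

text \<open>An injection of the column indices into the row indices places the coordinates of \<open>x\<close> among those of \<open>E *v x\<close>.\<close>

lemma norm_expanding_matrix_exists:
  assumes "CARD('b) \<le> CARD('a)"
  obtains E :: "real^'b^'a" where "\<And>x. norm x \<le> norm (E *v x)"
proof -
  obtain e :: "'b \<Rightarrow> 'a" where e: "inj e"
    using assms card_le_inj[of "UNIV :: 'b set" "UNIV :: 'a set"] by auto
  define E :: "real^'b^'a" where "E = (\<chi> i j. if i = e j then 1 else 0)"
  have Ex: "(E *v x) $ e j = x $ j" for x j
  proof -
    have "(if j = k then 1 else 0) * x $ k = (if j = k then x $ k else 0)" for k by simp
    then show ?thesis using e by (simp add: E_def matrix_vector_mult_def inj_eq)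
  qed
  have "norm x \<le> norm (E *v x)" for x
  proof -
    have "(norm x)\<^sup>2 = (\<Sum>i\<in>range e. ((E *v x) $ i)\<^sup>2)"
      by (simp add: norm_sq_vec sum.reindex[OF e] Ex)
    also have "\<dots> \<le> (norm (E *v x))\<^sup>2"
      unfolding norm_sq_vec by (intro sum_mono2) auto
    finally show ?thesis by simp
  qed
  then show ?thesis by (rule that)
qed

text \<open>The Gram determinant is a polynomial in \<open>t\<close>. It is not the zero polynomial, because for \<open>t > norm Y\<close> the matrix \<open>t E\<close>
  outweighs \<open>Y\<close> on every vector.\<close>

lemma finite_singular_pencil:
  fixes Y E :: "real^'b^'a"
  assumes E: "\<And>x. norm x \<le> norm (E *v x)"
  shows "finite {t. det (transpose (Y + t *\<^sub>R E) ** (Y + t *\<^sub>R E)) = 0}"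
proof (rule real_polynomial_function_finite_roots)
  show "real_polynomial_function (\<lambda>t. det (transpose (Y + t *\<^sub>R E) ** (Y + t *\<^sub>R E)))"
  proof (rule real_polynomial_function_det)
    fix i j
    have entry: "real_polynomial_function (\<lambda>t. Y $ k $ i + t * E $ k $ i)" for k i
      by (intro real_polynomial_function.intros bounded_linear_mult_left)
    have "real_polynomial_function (\<lambda>t. \<Sum>k\<in>UNIV. (Y $ k $ i + t * E $ k $ i) * (Y $ k $ j + t * E $ k $ j))"
      by (intro real_polynomial_function_sum real_polynomial_function.intros(4) entry finite)
    then show "real_polynomial_function (\<lambda>t. (transpose (Y + t *\<^sub>R E) ** (Y + t *\<^sub>R E)) $ i $ j)"
      by (simp add: matrix_matrix_mult_def transpose_def)
  qed
  \<comment> \<open>Any value above \<open>norm Y\<close> serves as a point where the determinant is nonzero.\<close>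
  define s where "s = norm Y + 1"
  show "det (transpose (Y + s *\<^sub>R E) ** (Y + s *\<^sub>R E)) \<noteq> 0"
  proof (rule det_gram_nonzero)
    fix x assume "(Y + s *\<^sub>R E) *v x = 0"
    then have "Y *v x = - (s *\<^sub>R (E *v x))"
      by (simp add: matrix_vector_mult_add_rdistrib scaleR_matrix_vector_assoc add_eq_0_iff2)
    then have "s * norm (E *v x) \<le> norm Y * norm x"
      using norm_matrix_vector_mult_le[of Y x] by (simp add: s_def)
    moreover have "s * norm x \<le> s * norm (E *v x)"
      using E by (intro mult_left_mono) (auto simp: s_def add_nonneg_nonneg)
    ultimately have "s * norm x \<le> norm Y * norm x" by linarith
    then have "norm x \<le> 0" by (simp add: s_def algebra_simps)
    then show "x = 0" by simp
  qed
qed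

lemma AE_full_rank: "AE Y in lborel. full_rank (Y :: real^'b^'a)"
proof (cases "CARD('b) \<le> CARD('a)")
  case True
  obtain E :: "real^'b^'a" where E: "\<And>x. norm x \<le> norm (E *v x)"
    using norm_expanding_matrix_exists[OF True] by blast
  have "AE Y :: real^'b^'a in lborel. det (transpose Y ** Y) \<noteq> 0"
    by (rule AE_nonzero_of_finite_on_lines[of _ E] borel_measurable_continuous_onI
      continuous_on_det continuous_on_matrix_matrix_mult continuous_on_transpose continuous_on_id finite_singular_pencil E)+
  then show ?thesis by eventually_elim (simp add: full_rank_def)
next
  case False
  then obtain E :: "real^'a^'b" where E: "\<And>x. norm x \<le> norm (E *v x)"
    using norm_expanding_matrix_exists[where 'a='b and 'b='a] by (metis nat_le_linear)
  have "finite {t. det ((Y + t *\<^sub>R transpose E) ** transpose (Y + t *\<^sub>R transpose E)) = 0}" for Y :: "real^'b^'a"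
    using finite_singular_pencil[OF E, of "transpose Y"]
    by (simp add: transpose_distribs transpose_scalar)
  then have "AE Y :: real^'b^'a in lborel. det (Y ** transpose Y) \<noteq> 0"
    by (intro AE_nonzero_of_finite_on_lines[of _ "transpose E"] borel_measurable_continuous_onI
      continuous_on_det continuous_on_matrix_matrix_mult continuous_on_transpose continuous_on_id)
  then show ?thesis by eventually_elim (simp add: full_rank_def)
qed

section \<open>The law of the Gaussian matrix\<close>

lemma prod_Basis_vec:
  fixes g :: "'a::euclidean_space^'n \<Rightarrow> real"
  shows "prod g Basis = (\<Prod>i\<in>UNIV. \<Prod>b\<in>Basis. g (axis i b))"
proof -
  have B: "(Basis :: ('a^'n) set) = (\<lambda>(i, b). axis i b) ` (UNIV \<times> Basis)"
    by (auto simp: Basis_vec_def)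
  have "inj_on (\<lambda>(i, b). axis i b :: 'a^'n) (UNIV \<times> Basis)"
    by (auto simp: inj_on_def axis_eq_axis)
  then show ?thesis
    unfolding B by (subst prod.reindex) (simp_all add: prod.cartesian_product case_prod_unfold)
qed

lemma measurable_vec_lambda:
  "(\<lambda>f. (\<chi> i. f i)) \<in> (\<Pi>\<^sub>M (i :: 'n::finite)\<in>UNIV. borel :: 'a::euclidean_space measure) \<rightarrow>\<^sub>M borel"
  by (subst borel_measurable_euclidean_space) (auto simp: Basis_vec_def inner_axis)

text \<open>The two measures agree on boxes. The identity turns independence of the rows, a statement about product measures, into one
  about null sets of matrices.\<close>

lemma distr_PiM_lborel_vec:
  "distr (\<Pi>\<^sub>M i\<in>UNIV. lborel) borel (\<lambda>f. (\<chi> i. f i)) = (lborel :: ('a::euclidean_space^'n) measure)"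
proof (rule lborel_eqI[symmetric])
  interpret product_sigma_finite "\<lambda>i :: 'n. lborel :: 'a measure" by standard
  have [measurable]: "(\<lambda>f. (\<chi> i. f i)) \<in> (\<Pi>\<^sub>M (i :: 'n)\<in>UNIV. lborel :: 'a measure) \<rightarrow>\<^sub>M borel"
    using measurable_vec_lambda by (simp cong: measurable_cong_sets sets_PiM_cong)
  fix l u :: "'a^'n" assume le: "\<And>b. b \<in> Basis \<Longrightarrow> l \<bullet> b \<le> u \<bullet> b"
  have le': "l $ i \<bullet> b \<le> u $ i \<bullet> b" if "b \<in> Basis" for i b
    using le[of "axis i b"] that by (simp add: axis_in_Basis_iff inner_axis)
  have "emeasure (distr (\<Pi>\<^sub>M i\<in>UNIV. lborel) borel (\<lambda>f. (\<chi> i. f i))) (box l u)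
      = emeasure (\<Pi>\<^sub>M i\<in>UNIV. lborel) ((\<lambda>f. (\<chi> i. f i)) -` box l u \<inter> space (\<Pi>\<^sub>M i\<in>UNIV. lborel))"
    by (rule emeasure_distr) auto
  also have "(\<lambda>f. (\<chi> i. f i)) -` box l u \<inter> space (\<Pi>\<^sub>M i\<in>UNIV. lborel) = (\<Pi>\<^sub>E i\<in>UNIV. box (l $ i) (u $ i))"
    by (auto simp: space_PiM mem_box Basis_vec_def inner_axis PiE_def Pi_def)
  also have "emeasure (\<Pi>\<^sub>M i\<in>UNIV. lborel) \<dots> = (\<Prod>i\<in>UNIV. emeasure lborel (box (l $ i) (u $ i)))"
    by (rule emeasure_PiM) auto
  also have "\<dots> = (\<Prod>i\<in>UNIV. ennreal (\<Prod>b\<in>Basis. (u $ i - l $ i) \<bullet> b))"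
    using le' by (simp add: emeasure_lborel_box)
  also have "\<dots> = (\<Prod>b\<in>Basis. (u - l) \<bullet> b)"
    using le' unfolding prod_Basis_vec
    by (subst prod_ennreal) (auto intro!: prod_nonneg simp: inner_axis inner_diff_left)
  finally show "emeasure (distr (\<Pi>\<^sub>M i\<in>UNIV. lborel) borel (\<lambda>f. (\<chi> i. f i))) (box l u) = (\<Prod>b\<in>Basis. (u - l) \<bullet> b)" .
qed simp

text \<open>The product of the densities is a density of the product.\<close>

lemma PiM_density_AE:
  fixes g :: "'a::euclidean_space \<Rightarrow> real"
  assumes [measurable]: "g \<in> borel_measurable borel" and "sigma_finite_measure (density lborel g)"
    and "AE f in (\<Pi>\<^sub>M (i :: 'n::finite)\<in>UNIV. lborel). P f"
  shows "AE f in (\<Pi>\<^sub>M (i :: 'n)\<in>UNIV. density lborel g). P f"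
proof -
  interpret L: product_sigma_finite "\<lambda>i :: 'n. lborel :: 'a measure" by standard
  interpret D: product_sigma_finite "\<lambda>i :: 'n. density lborel g" 
    using assms(2) by (simp add: product_sigma_finite_def)
  let ?L = "\<Pi>\<^sub>M (i :: 'n)\<in>UNIV. lborel :: 'a measure"
  have [measurable]: "(\<lambda>f. \<Prod>i\<in>UNIV. ennreal (g (f i))) \<in> borel_measurable ?L"
    by measurable
  have "density ?L (\<lambda>f. \<Prod>i\<in>UNIV. ennreal (g (f i))) = (\<Pi>\<^sub>M (i :: 'n)\<in>UNIV. density lborel g)"
  proof (rule D.PiM_eqI)
    show "sets (density ?L (\<lambda>f. \<Prod>i\<in>UNIV. ennreal (g (f i)))) = sets (\<Pi>\<^sub>M (i :: 'n)\<in>UNIV. density lborel g)"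
      by (simp cong: sets_PiM_cong)
    fix S :: "'n \<Rightarrow> 'a set" assume "\<And>i. i \<in> UNIV \<Longrightarrow> S i \<in> sets (density lborel g)"
    then have [measurable]: "\<And>i. S i \<in> sets borel" by simp
    have "Pi\<^sub>E UNIV S \<in> sets ?L" by (intro sets_PiM_I_finite) auto
    then have "emeasure (density ?L (\<lambda>f. \<Prod>i\<in>UNIV. ennreal (g (f i)))) (Pi\<^sub>E UNIV S)
      = (\<integral>\<^sup>+f. (\<Prod>i\<in>UNIV. ennreal (g (f i))) * indicator (Pi\<^sub>E UNIV S) f \<partial>?L)"
      by (intro emeasure_density) auto
    also have "\<dots> = (\<integral>\<^sup>+f. (\<Prod>i\<in>UNIV. ennreal (g (f i)) * indicator (S i) (f i)) \<partial>?L)"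
      by (intro nn_integral_cong) (auto simp: prod.distrib indicator_def PiE_def Pi_def prod_zero_iff)
    also have "\<dots> = (\<Prod>i\<in>UNIV. \<integral>\<^sup>+x. ennreal (g x) * indicator (S i) x \<partial>lborel)"
      by (rule L.product_nn_integral_prod) auto
    also have "\<dots> = (\<Prod>i\<in>UNIV. emeasure (density lborel g) (S i))"
      by (simp add: emeasure_density)
    finally show "emeasure (density ?L (\<lambda>f. \<Prod>i\<in>UNIV. ennreal (g (f i)))) (Pi\<^sub>E UNIV S)
      = (\<Prod>i\<in>UNIV. emeasure (density lborel g) (S i))" .
  qed simp
  moreover have "AE f in density ?L (\<lambda>f. \<Prod>i\<in>UNIV. ennreal (g (f i))). P f"
    using assms(3) by (subst AE_density) auto
  ultimately show ?thesis by (simp only:)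
qed

text \<open>The law of a Gaussian matrix is absolutely continuous with respect to Lebesgue measure on the space of matrices.\<close>

lemma gaussian_matrix_AE:
  fixes Y :: "'w \<Rightarrow> real^'p^'n"
  assumes M: "prob_space M" and Y: "gaussian_matrix M Y \<Sigma>" and AE: "AE y in lborel. P y"
  shows "AE \<omega> in M. P (Y \<omega>)"
proof -
  interpret prob_space M by fact
  have meas [measurable]: "Y \<in> borel_measurable M"
    and ind: "indep_vars (\<lambda>_. borel) (\<lambda>i \<omega>. Y \<omega> $ i) UNIV"
    and row: "\<And>i. distributed M lborel (\<lambda>\<omega>. Y \<omega> $ i) (\<lambda>x. ennreal (mvn_density 0 \<Sigma> x))"
    using Y by (auto simp: gaussian_matrix_def gaussian_vector_def)
  define g :: "real^'p \<Rightarrow> real" where "g = mvn_density 0 \<Sigma>"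
  have g [measurable]: "g \<in> borel_measurable borel"
    unfolding g_def mvn_density_def
    by (intro borel_measurable_divide borel_measurable_const borel_measurable_continuous_onI continuous_intros continuous_on_matrix_vector_mult) simp_all
  have rv: "random_variable borel (\<lambda>\<omega>. Y \<omega> $ i)" for i
    by (rule measurable_compose[OF meas borel_measurable_continuous_onI]) (intro continuous_intros)
  have law: "distr M borel (\<lambda>\<omega>. Y \<omega> $ i) = density lborel g" for i
    using distributed_distr_eq_density[OF row[of i]] by (simp add: g_def cong: distr_cong)
  have sf: "sigma_finite_measure (density lborel g)"
    unfolding law[of undefined, symmetric]
    by (intro prob_space_imp_sigma_finite prob_space_distr rv)
  have vec [measurable]: "(\<lambda>f. (\<chi> i. f i)) \<in> (\<Pi>\<^sub>M (i :: 'n)\<in>UNIV. borel :: (real^'p) measure) \<rightarrow>\<^sub>M borel"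
    by (rule measurable_vec_lambda)
  have "AE y in distr (\<Pi>\<^sub>M i\<in>UNIV. lborel) borel (\<lambda>f. (\<chi> i. f i)). P (y :: real^'p^'n)"
    unfolding distr_PiM_lborel_vec by (rule AE)
  then have "AE f in (\<Pi>\<^sub>M (i :: 'n)\<in>UNIV. lborel). P (\<chi> i. f i)"
    by (rule AE_distrD[rotated]) (simp cong: measurable_cong_sets sets_PiM_cong)
  then have "AE f in (\<Pi>\<^sub>M (i :: 'n)\<in>UNIV. density lborel g). P (\<chi> i. f i)"
    by (rule PiM_density_AE[OF g sf])
  moreover have "distr M (\<Pi>\<^sub>M i\<in>UNIV. borel) (\<lambda>\<omega>. \<lambda>i\<in>UNIV. Y \<omega> $ i)
      = (\<Pi>\<^sub>M i\<in>UNIV. distr M borel (\<lambda>\<omega>. Y \<omega> $ i))"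
    by (rule indep_vars_iff_distr_eq_PiM[THEN iffD1, OF _ rv ind]) simp
  moreover have "\<dots> = (\<Pi>\<^sub>M i\<in>UNIV. density lborel g)"
    by (intro PiM_cong refl law)
  ultimately have "AE f in distr M (\<Pi>\<^sub>M i\<in>UNIV. borel) (\<lambda>\<omega>. \<lambda>i\<in>UNIV. Y \<omega> $ i). P (\<chi> i. f i)"
    by (simp only:)
  then have "AE \<omega> in M. P (\<chi> i. (\<lambda>i\<in>UNIV. Y \<omega> $ i) i)"
    by (rule AE_distrD[rotated]) (rule measurable_restrict, rule rv)
  then show ?thesis by simp
qed

section \<open>Measurability\<close>

lemma borel_measurable_matrix_vector_mult [measurable]:
  fixes f :: "'w \<Rightarrow> real^'b^'a"
  assumes "f \<in> borel_measurable M" "g \<in> borel_measurable M"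
  shows "(\<lambda>w. f w *v g w) \<in> borel_measurable M"
  using assms by (rule borel_measurable_continuous_Pair) (intro continuous_on_matrix_vector_mult continuous_intros)

lemma borel_measurable_matrix_matrix_mult [measurable]:
  fixes f :: "'w \<Rightarrow> real^'b^'a" and g :: "'w \<Rightarrow> real^'c^'b"
  assumes "f \<in> borel_measurable M" "g \<in> borel_measurable M"
  shows "(\<lambda>w. f w ** g w) \<in> borel_measurable M"
  using assms by (rule borel_measurable_continuous_Pair) (intro continuous_on_matrix_matrix_mult continuous_intros)

lemma borel_measurable_transpose [measurable]:
  fixes f :: "'w \<Rightarrow> real^'b^'a"
  assumes "f \<in> borel_measurable M"
  shows "(\<lambda>w. transpose (f w)) \<in> borel_measurable M"
  by (rule measurable_compose[OF assms borel_measurable_continuous_onI])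
    (intro continuous_on_transpose continuous_on_id)

lemma borel_measurable_trace [measurable]:
  fixes f :: "'w \<Rightarrow> real^'a^'a"
  assumes "f \<in> borel_measurable M"
  shows "(\<lambda>w. trace (f w)) \<in> borel_measurable M"
  by (rule measurable_compose[OF assms borel_measurable_continuous_onI])
    (auto simp: trace_def intro!: continuous_intros)

text \<open>A derivative need not be continuous, but it is a pointwise limit of measurable difference quotients.\<close>

lemma borel_measurable_deriv:
  fixes r :: "real \<Rightarrow> real"
  assumes r: "\<And>x. r differentiable (at x)"
  shows "r \<in> borel_measurable borel" "deriv r \<in> borel_measurable borel"
proof -
  show [measurable]: "r \<in> borel_measurable borel"
    using r by (intro borel_measurable_continuous_onI)
      (meson continuous_at_imp_continuous_on differentiable_imp_continuous_within)
  show "deriv r \<in> borel_measurable borel"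
  proof (rule borel_measurable_LIMSEQ_real)
    show "(\<lambda>x. (r (x + inverse (real (Suc n))) - r x) / inverse (real (Suc n))) \<in> borel_measurable borel" for n
      by measurable
    fix x
    have "((\<lambda>h. (r (x + h) - r x) / h) \<longlongrightarrow> deriv r x) (at 0)"
      using r[of x] by (simp add: DERIV_deriv_iff_real_differentiable[symmetric] DERIV_def)
    moreover have "filterlim (\<lambda>n. inverse (real (Suc n))) (at 0) sequentially"
      by (intro filterlim_atI LIMSEQ_inverse_real_of_nat) auto
    ultimately show "(\<lambda>n. (r (x + inverse (real (Suc n))) - r x) / inverse (real (Suc n))) \<longlonglongrightarrow> deriv r x"
      by (rule filterlim_compose)
  qed
qed

section \<open>Gaussian densities and moments\<close>

lemma sym_pos_def_det: "sym_pos_def A \<Longrightarrow> det A \<noteq> 0"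
proof -
  assume A: "sym_pos_def A"
  have "x = 0" if "A *v x = 0" for x
    using A that unfolding sym_pos_def_def by (metis inner_zero_right less_irrefl)
  then have "\<exists>N. N ** A = mat 1" by (simp add: matrix_left_invertible_ker)
  then show "det A \<noteq> 0" by (simp add: invertible_det_nz[symmetric] invertible_left_inverse)
qed

text \<open>With \<open>z = \<Sigma>\<^sup>-\<^sup>1 y\<close> and \<open>\<Sigma> = A A\<close> the quadratic form in the exponent is \<open>y \<bullet> z = (norm (A z))\<^sup>2\<close>, while \<open>norm y\<close> is at most
  \<open>norm A\<close> times \<open>norm (A z)\<close>.\<close>

lemma mvn_density_le_gauss:
  fixes A \<Sigma> :: "real^'p^'p"
  assumes A: "sym_pos_def A" and AA: "A ** A = \<Sigma>"
  obtains c K where "0 < c" "0 \<le> K" "\<And>\<mu> x. mvn_density \<mu> \<Sigma> x \<le> K * gauss c (x - \<mu>)"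
proof -
  \<comment> \<open>The summand one only ensures that \<open>m\<close> is positive.\<close>
  define m where "m = (norm A)\<^sup>2 + 1"
  define c where "c = 1 / (2 * m)"
  define K where "K = \<bar>1 / sqrt ((2 * pi) ^ CARD('p) * det \<Sigma>)\<bar>"
  have m: "0 < m" by (simp add: m_def add_nonneg_pos)
  have "det \<Sigma> \<noteq> 0" using sym_pos_def_det[OF A] by (simp add: AA[symmetric] det_mul)
  note inv = matrix_inv_mult(2)[OF this]
  have quad: "c * (norm y)\<^sup>2 \<le> (y \<bullet> (matrix_inv \<Sigma> *v y)) / 2" for y
  proof -
    define z where "z = matrix_inv \<Sigma> *v y"
    have y: "y = A *v (A *v z)"
      by (simp add: z_def matrix_vector_mul_assoc matrix_mul_assoc AA inv)
    have "y \<bullet> z = (norm (A *v z))\<^sup>2"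
      using A unfolding y by (simp add: power2_norm_eq_inner inner_commute[of "A *v (A *v z)"]
          inner_transpose_mult[of z] sym_pos_def_def)
    moreover have "(norm y)\<^sup>2 \<le> (norm A * norm (A *v z))\<^sup>2"
      unfolding y by (intro power_mono norm_matrix_vector_mult_le) simp
    then have "(norm y)\<^sup>2 \<le> m * (norm (A *v z))\<^sup>2"
      using zero_le_power2[of "norm (A *v z)"] unfolding m_def distrib_right power_mult_distrib by linarith
    ultimately show ?thesis
      using m by (simp add: c_def z_def[symmetric] field_simps)
  qed
  show ?thesis
  proof (rule that[of c K])
    fix \<mu> x
    have "mvn_density \<mu> \<Sigma> x \<le> \<bar>mvn_density \<mu> \<Sigma> x\<bar>" by simp
    also have "\<dots> = K * exp (- ((x - \<mu>) \<bullet> (matrix_inv \<Sigma> *v (x - \<mu>))) / 2)"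
      by (simp add: mvn_density_def K_def abs_mult)
    also have "\<dots> \<le> K * gauss c (x - \<mu>)"
      using quad[of "x - \<mu>"] by (intro mult_left_mono) (simp_all add: gauss_def K_def)
    finally show "mvn_density \<mu> \<Sigma> x \<le> K * gauss c (x - \<mu>)" .
  qed (simp_all add: c_def m K_def)
qed

lemma gaussian_nn_integral_le:
  fixes X :: "'w \<Rightarrow> real^'p"
  assumes X: "gaussian_vector M X \<mu> \<Sigma>" and K: "0 \<le> K" and le: "\<And>x. mvn_density \<mu> \<Sigma> x \<le> K * gauss c (x - \<mu>)"
    and h [measurable]: "h \<in> borel_measurable borel"
  shows "(\<integral>\<^sup>+\<omega>. h (X \<omega>) \<partial>M) \<le> ennreal K * (\<integral>\<^sup>+x. h x * gauss c (x - \<mu>) \<partial>lborel)"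
proof -
  have "(\<integral>\<^sup>+\<omega>. h (X \<omega>) \<partial>M) = (\<integral>\<^sup>+x. mvn_density \<mu> \<Sigma> x * h x \<partial>lborel)"
    using X by (intro distributed_nn_integral[symmetric]) (simp_all add: gaussian_vector_def)
  also have "\<dots> \<le> (\<integral>\<^sup>+x. ennreal K * (h x * gauss c (x - \<mu>)) \<partial>lborel)"
  proof (rule nn_integral_mono)
    fix x
    have "ennreal (mvn_density \<mu> \<Sigma> x) * h x \<le> ennreal (K * gauss c (x - \<mu>)) * h x"
      by (intro mult_right_mono ennreal_leI le) simp
    also have "\<dots> = ennreal K * (h x * gauss c (x - \<mu>))"
      using K by (simp add: ennreal_mult less_imp_le[OF gauss_pos] mult_ac)
    finally show "ennreal (mvn_density \<mu> \<Sigma> x) * h x \<le> ennreal K * (h x * gauss c (x - \<mu>))" .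
  qed
  also have "\<dots> = ennreal K * (\<integral>\<^sup>+x. h x * gauss c (x - \<mu>) \<partial>lborel)"
    by (rule nn_integral_cmult) measurable
  finally show ?thesis .
qed

lemma gaussian_matrix_second_moment:
  fixes Y :: "'w \<Rightarrow> real^'p^'n"
  assumes A: "sym_pos_def A" "A ** A = \<Sigma>" and Y: "gaussian_matrix M Y \<Sigma>"
  shows "(\<integral>\<^sup>+\<omega>. ennreal ((norm (Y \<omega>))\<^sup>2) \<partial>M) < \<infinity>"
proof -
  obtain c K where c: "0 < c" "0 \<le> K" "\<And>\<mu> x. mvn_density \<mu> \<Sigma> x \<le> K * gauss c (x - \<mu>)"
    using mvn_density_le_gauss[OF A] by metis
  have row: "gaussian_vector M (\<lambda>\<omega>. Y \<omega> $ i) 0 \<Sigma>" for i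
    using Y by (auto simp: gaussian_matrix_def)
  have [measurable]: "(\<lambda>\<omega>. Y \<omega> $ i) \<in> borel_measurable M" for i
    using row[of i] by (auto simp: gaussian_vector_def distributed_def measurable_lborel1)
  have fin: "(\<integral>\<^sup>+\<omega>. ennreal ((norm (Y \<omega> $ i))\<^sup>2) \<partial>M) < \<infinity>" for i
  proof -
    have "(\<integral>\<^sup>+\<omega>. ennreal ((norm (Y \<omega> $ i))\<^sup>2) \<partial>M)
        \<le> ennreal K * (\<integral>\<^sup>+x. ennreal ((norm (x :: real^'p))\<^sup>2) * gauss c (x - 0) \<partial>lborel)"
      by (rule gaussian_nn_integral_le[OF row c(2,3), where h="\<lambda>x. ennreal ((norm x)\<^sup>2)"]) measurable
    also have "\<dots> < \<infinity>"
      using nn_integral_norm_sq_gauss[OF c(1), where 'a="real^'p"] by (simp add: ennreal_mult_less_top)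
    finally show ?thesis .
  qed
  have "(\<integral>\<^sup>+\<omega>. ennreal ((norm (Y \<omega>))\<^sup>2) \<partial>M) = (\<integral>\<^sup>+\<omega>. (\<Sum>i\<in>UNIV. ennreal ((norm (Y \<omega> $ i))\<^sup>2)) \<partial>M)"
    by (simp add: norm_sq_matrix)
  also have "\<dots> = (\<Sum>i\<in>UNIV. \<integral>\<^sup>+\<omega>. ennreal ((norm (Y \<omega> $ i))\<^sup>2) \<partial>M)"
    by (rule nn_integral_sum) measurable
  also have "\<dots> < \<infinity>" using fin by simp
  finally show ?thesis .
qed

text \<open>Tonelli's theorem for the joint law, with both integrals pulled back to the probability space.\<close>

lemma nn_integral_indep_rv:
  fixes X :: "'w \<Rightarrow> 'a::euclidean_space" and Y :: "'w \<Rightarrow> 'b::euclidean_space"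
  assumes M: "prob_space M" and ind: "indep_rv M X Y"
    and h [measurable]: "case_prod h \<in> borel_measurable (borel \<Otimes>\<^sub>M borel)"
  shows "(\<integral>\<^sup>+\<omega>. h (X \<omega>) (Y \<omega>) \<partial>M) = (\<integral>\<^sup>+\<omega>'. (\<integral>\<^sup>+\<omega>. h (X \<omega>) (Y \<omega>') \<partial>M) \<partial>M)"
proof -
  interpret prob_space M by fact
  have [measurable]: "X \<in> borel_measurable M" "Y \<in> borel_measurable M"
    and set: "indep_set (sigma_sets (space M) {X -` B \<inter> space M | B. B \<in> sets borel})
       (sigma_sets (space M) {Y -` B \<inter> space M | B. B \<in> sets borel})"
    using ind by (auto simp: indep_rv_def)
  interpret X: prob_space "distr M borel X" by (rule prob_space_distr) measurable
  interpret Y: prob_space "distr M borel Y" by (rule prob_space_distr) measurable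
  interpret XY: pair_sigma_finite "distr M borel X" "distr M borel Y" ..
  have law: "distr M borel X \<Otimes>\<^sub>M distr M borel Y = distr M (borel \<Otimes>\<^sub>M borel) (\<lambda>\<omega>. (X \<omega>, Y \<omega>))"
  proof (rule pair_measure_eqI)
    fix S T assume "S \<in> sets (distr M borel X)" "T \<in> sets (distr M borel Y)"
    then have [measurable]: "S \<in> sets borel" "T \<in> sets borel" by auto
    have "prob ((X -` S \<inter> space M) \<inter> (Y -` T \<inter> space M)) = prob (X -` S \<inter> space M) * prob (Y -` T \<inter> space M)"
      by (rule indep_setD[OF set]) (auto intro!: sigma_sets.Basic)
    moreover have "(X -` S \<inter> space M) \<inter> (Y -` T \<inter> space M) = (\<lambda>\<omega>. (X \<omega>, Y \<omega>)) -` (S \<times> T) \<inter> space M"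
      by auto
    ultimately show "emeasure (distr M borel X) S * emeasure (distr M borel Y) T
        = emeasure (distr M (borel \<Otimes>\<^sub>M borel) (\<lambda>\<omega>. (X \<omega>, Y \<omega>))) (S \<times> T)"
      by (simp add: emeasure_distr emeasure_eq_measure ennreal_mult[symmetric])
  qed (auto intro: X.sigma_finite_measure_axioms Y.sigma_finite_measure_axioms)
  have "(\<integral>\<^sup>+\<omega>. h (X \<omega>) (Y \<omega>) \<partial>M) = (\<integral>\<^sup>+p. case_prod h p \<partial>distr M (borel \<Otimes>\<^sub>M borel) (\<lambda>\<omega>. (X \<omega>, Y \<omega>)))"
    by (subst nn_integral_distr) auto
  also have "\<dots> = (\<integral>\<^sup>+y. (\<integral>\<^sup>+x. h x y \<partial>distr M borel X) \<partial>distr M borel Y)"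
    unfolding law[symmetric] by (subst XY.nn_integral_snd[symmetric]) (auto cong: measurable_cong_sets sets_pair_measure_cong)
  also have "\<dots> = (\<integral>\<^sup>+y. (\<integral>\<^sup>+\<omega>. h (X \<omega>) y \<partial>M) \<partial>distr M borel Y)"
    by (intro nn_integral_cong nn_integral_distr) measurable
  also have "\<dots> = (\<integral>\<^sup>+\<omega>'. (\<integral>\<^sup>+\<omega>. h (X \<omega>) (Y \<omega>') \<partial>M) \<partial>M)"
    by (intro nn_integral_distr) measurable
  finally show ?thesis .
qed

section \<open>Integrability of the divergence\<close>

text \<open>The inner integral over \<open>X\<close> is bounded by a constant times \<open>(norm y)\<^sup>2\<close>, the same constant for almost every value \<open>y\<close> of \<open>Y\<close>, and the second
  moment of \<open>Y\<close> is finite.\<close>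

lemma inverse_projection_moment:
  fixes X :: "'w \<Rightarrow> real^'p" and Y :: "'w \<Rightarrow> real^'p^'n"
  assumes M: "prob_space M" and A: "sym_pos_def A" "A ** A = \<Sigma>"
    and X: "gaussian_vector M X \<theta> \<Sigma>" and Y: "gaussian_matrix M Y \<Sigma>" and ind: "indep_rv M X Y"
    and good: "AE \<omega> in M. full_rank (Y \<omega>) \<and> 2 < rank (transpose (Y \<omega>) ** Y \<omega>)"
  shows "(\<integral>\<^sup>+\<omega>. ennreal ((norm (Y \<omega>))\<^sup>2) * inverse (ennreal ((norm ((pinv (Y \<omega>) ** Y \<omega>) *v X \<omega>))\<^sup>2)) \<partial>M) < \<infinity>"
proof -
  interpret prob_space M by fact
  have [measurable]: "X \<in> borel_measurable M" "Y \<in> borel_measurable M"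
    using ind by (auto simp: indep_rv_def)
  obtain c K where c: "0 < c" "0 \<le> K" "\<And>\<mu> x. mvn_density \<mu> \<Sigma> x \<le> K * gauss c (x - \<mu>)"
    using mvn_density_le_gauss[OF A] by metis
  obtain K1 where K1: "K1 < \<infinity>" and
    K1_le: "\<forall>(V :: (real^'p) set) P a. subspace V \<and> 3 \<le> dim V \<and> (\<forall>u\<in>V. \<forall>x. u \<bullet> P x = u \<bullet> x) \<longrightarrow>
      (\<integral>\<^sup>+x. inverse (ennreal ((norm (P x))\<^sup>2)) * gauss c (x - a) \<partial>lborel) \<le> K1"
    using nn_integral_inverse_projection_gauss[OF c(1), where 'a="real^'p"] by (elim exE conjE)
  define h where "h x y = ennreal ((norm y)\<^sup>2) * inverse (ennreal ((norm ((pinv y ** y) *v x))\<^sup>2))"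
    for x :: "real^'p" and y :: "real^'p^'n"
  have [measurable]: "case_prod h \<in> borel_measurable (borel \<Otimes>\<^sub>M borel)"
    unfolding h_def[abs_def] by measurable
  have inner: "(\<integral>\<^sup>+\<omega>. h (X \<omega>) y \<partial>M) \<le> ennreal ((norm y)\<^sup>2) * (ennreal K * K1)"
    if y: "full_rank y" "2 < rank (transpose y ** y)" for y
  proof -
    define P where "P = pinv y ** y"
    have P: "P = mp_inverse y ** y" using y(1) by (simp add: P_def pinv_def)
    note f = mp_inverse_projection_facts[OF full_rank_mp_inverse(1)[OF y(1)]]
    define V where "V = range ((*v) P)"
    have "subspace V"
      unfolding V_def by (rule linear_subspace_image) auto
    moreover have "3 \<le> dim V"
    proof -
      \<comment> \<open>\<open>P\<close> fixes the range of \<open>y\<^sup>T\<close>, so its own range is at least as large as that of \<open>y\<^sup>T y\<close>.\<close>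
      have "range ((*v) (transpose y ** y)) \<subseteq> V"
      proof
        fix u assume "u \<in> range ((*v) (transpose y ** y))"
        then obtain z where "u = (transpose y ** y) *v z" by auto
        also have "\<dots> = P *v ((transpose y ** y) *v z)"
          by (simp only: P matrix_vector_mul_assoc matrix_mul_assoc f)
        finally show "u \<in> V" by (auto simp: V_def)
      qed
      then have "dim (range ((*v) (transpose y ** y))) \<le> dim V" by (rule dim_subset)
      with y(2) show ?thesis by (simp add: rank_dim_range)
    qed
    moreover have "u \<bullet> (P *v x) = u \<bullet> x" if "u \<in> V" for u x
    proof -
      obtain z where u: "u = P *v z" using \<open>u \<in> V\<close> by (auto simp: V_def)
      have "transpose P *v u = u"
        by (simp only: u P f matrix_vector_mul_assoc matrix_mul_assoc)
      then show ?thesis by (simp add: inner_transpose_mult[of u])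
    qed
    ultimately have "(\<integral>\<^sup>+x. inverse (ennreal ((norm (P *v x))\<^sup>2)) * gauss c (x - \<theta>) \<partial>lborel) \<le> K1"
      by (intro K1_le[rule_format] conjI ballI allI) auto
    then have "(\<integral>\<^sup>+\<omega>. inverse (ennreal ((norm (P *v X \<omega>))\<^sup>2)) \<partial>M) \<le> ennreal K * K1"
      by (intro order_trans[OF gaussian_nn_integral_le[OF X c(2,3), where h="\<lambda>x. inverse (ennreal ((norm (P *v x))\<^sup>2))"]]
          mult_left_mono) auto
    then have "ennreal ((norm y)\<^sup>2) * (\<integral>\<^sup>+\<omega>. inverse (ennreal ((norm (P *v X \<omega>))\<^sup>2)) \<partial>M) \<le> ennreal ((norm y)\<^sup>2) * (ennreal K * K1)"
      by (intro mult_left_mono) auto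
    then show ?thesis
      unfolding h_def P_def by (subst nn_integral_cmult) simp_all
  qed
  have "(\<integral>\<^sup>+\<omega>. h (X \<omega>) (Y \<omega>) \<partial>M) = (\<integral>\<^sup>+\<omega>'. (\<integral>\<^sup>+\<omega>. h (X \<omega>) (Y \<omega>') \<partial>M) \<partial>M)"
    by (rule nn_integral_indep_rv[OF M ind]) measurable
  also have "\<dots> \<le> (\<integral>\<^sup>+\<omega>'. ennreal ((norm (Y \<omega>'))\<^sup>2) * (ennreal K * K1) \<partial>M)"
  proof (rule nn_integral_mono_AE)
    show "AE \<omega>' in M. (\<integral>\<^sup>+\<omega>. h (X \<omega>) (Y \<omega>') \<partial>M) \<le> ennreal ((norm (Y \<omega>'))\<^sup>2) * (ennreal K * K1)"
      using good by eventually_elim (rule inner, auto)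
  qed
  also have "\<dots> = (\<integral>\<^sup>+\<omega>'. ennreal ((norm (Y \<omega>'))\<^sup>2) \<partial>M) * (ennreal K * K1)"
    by (rule nn_integral_multc) measurable
  also have "\<dots> < \<infinity>"
    using gaussian_matrix_second_moment[OF A Y] K1 by (simp add: ennreal_mult_less_top)
  finally show ?thesis by (simp add: h_def)
qed

text \<open>Used because the divergence itself is only known to agree almost everywhere with a Borel function of \<open>X\<close> and \<open>Y\<close>.\<close>

lemma borel_measurable_completion_AE:
  fixes f g :: "'w \<Rightarrow> real"
  assumes g: "g \<in> borel_measurable M" and eq: "AE \<omega> in M. f \<omega> = g \<omega>"
  shows "f \<in> borel_measurable (completion M)"
proof (rule measurableI)
  fix S :: "real set" assume S: "S \<in> sets borel"
  have sets: "g -` S \<inter> space M \<in> sets (completion M)"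
    using measurable_sets[OF g S] by (rule sets_completionI_sets)
  have AE: "AE \<omega> in completion M. (\<omega> \<in> g -` S \<inter> space M) \<longleftrightarrow> (\<omega> \<in> f -` S \<inter> space M)"
    using AE_completion[OF eq] by eventually_elim simp
  have "f -` S \<inter> space M \<subseteq> space (completion M)"
    by simp
  from completion.in_sets_AE[OF AE sets this] show "f -` S \<inter> space (completion M) \<in> sets (completion M)"
    by (simp only: space_completion)
qed simp

text \<open>The projection of \<open>x\<close> onto the row space equals \<open>Y\<^sup>T v\<close>.\<close>

lemma quadratic_form_lower_bound:
  fixes Y :: "real^'p^'n"
  assumes "full_rank Y"
  shows "(norm ((mp_inverse Y ** Y) *v x))\<^sup>2 \<le> (norm Y)\<^sup>2 * (mp_coord x Y \<bullet> mp_coord x Y)"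
proof -
  note f = mp_inverse_projection_facts[OF full_rank_mp_inverse(1)[OF assms]]
  have "(mp_inverse Y ** Y) *v x = transpose Y *v mp_coord x Y"
    by (simp only: mp_coord_def matrix_vector_mul_assoc f)
  then have "norm ((mp_inverse Y ** Y) *v x) \<le> norm Y * norm (mp_coord x Y)"
    using norm_matrix_vector_mult_le[of "transpose Y"] by (simp add: norm_transpose)
  from power_mono[OF this, of 2] show ?thesis
    by (simp add: power_mult_distrib power2_norm_eq_inner)
qed

text \<open>One of the two products of a full-rank matrix with its Moore-Penrose inverse is an identity matrix, and both have the same trace.\<close>

lemma trace_projection_bound:
  fixes Y :: "real^'p^'n"
  assumes "full_rank Y"
  shows "0 \<le> trace (mp_inverse Y ** Y)" "trace (mp_inverse Y ** Y) \<le> real CARD('n) + real CARD('p)"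
proof -
  have "trace (mp_inverse Y ** Y) = CARD('p) \<or> trace (mp_inverse Y ** Y) = CARD('n)"
    using full_rank_mp_inverse(2)[OF assms]
  proof
    assume "mp_inverse Y ** Y = mat 1"
    then show ?thesis by (simp only: trace_I simp_thms)
  next
    assume one: "Y ** mp_inverse Y = mat 1"
    show ?thesis unfolding trace_mul_sym[of "mp_inverse Y"] one by (simp only: trace_I simp_thms)
  qed
  then show "0 \<le> trace (mp_inverse Y ** Y)" "trace (mp_inverse Y ** Y) \<le> real CARD('n) + real CARD('p)"
    by auto
qed

(* The divergence exists only almost surely, and deriv is unspecified on the exceptional null set;
   integrability is therefore taken over the completion of M, which gives every M-integrable
   function the same expectation and ignores values on null sets. *)
theorem theorem1:
  fixes M :: "'w measure"
    and X :: "'w \<Rightarrow> real^'p"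
    and Y :: "'w \<Rightarrow> real^'p^'n"
    and \<theta> :: "real^'p"
    and \<Sigma> A :: "real^'p^'p"
    and r :: "real \<Rightarrow> real"
    and C1 C2 :: real
  assumes "prob_space M"
    and "sym_pos_def \<Sigma>"
    and "gaussian_vector M X \<theta> \<Sigma>"
    and "gaussian_matrix M Y \<Sigma>"
    and "indep_rv M X Y"
    and "sym_pos_def A" and "A ** A = \<Sigma>"
    and "\<And>x. r differentiable (at x)"
    and "\<And>x. 0 \<le> r x \<and> r x \<le> C1"
    and "\<And>x. \<bar>deriv r x\<bar> \<le> C2"
    and "measure M {\<omega> \<in> space M. rank (transpose (Y \<omega>) ** Y \<omega>) > 2} = 1"
  shows "(AE \<omega> in M.
            diag_partials_exist (\<lambda>Z. Z ** H_mat r A Z (X \<omega>)) (Y \<omega> ** matrix_inv A)) \<and>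
         integrable (completion M)
           (\<lambda>\<omega>. \<bar>matrix_div (\<lambda>Z. Z ** H_mat r A Z (X \<omega>)) (Y \<omega> ** matrix_inv A)\<bar>)"
proof -
  interpret prob_space M by fact
  note A = \<open>sym_pos_def A\<close> \<open>A ** A = \<Sigma>\<close> and rdiff = assms(8) and C1 = assms(9) and C2 = assms(10)
  have sym: "transpose A = A" using A(1) by (simp add: sym_pos_def_def)
  note inv = matrix_inv_mult[OF sym_pos_def_det[OF A(1)]]
  have ZA: "y ** matrix_inv A ** A = y" for y :: "real^'p^'n"
    by (simp add: matrix_mul_assoc[symmetric] inv)
  have [measurable]: "X \<in> borel_measurable M" "Y \<in> borel_measurable M"
    using assms(5) by (auto simp: indep_rv_def)
  note [measurable] = borel_measurable_deriv[OF rdiff]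
  \<comment> \<open>The measure of a set outside the sigma-algebra is zero by default, so measure one entails measurability.\<close>
  have ev: "{\<omega> \<in> space M. 2 < rank (transpose (Y \<omega>) ** Y \<omega>)} \<in> events"
    using assms(11) measure_notin_sets by fastforce
  have "AE \<omega> in M. \<omega> \<in> {\<omega> \<in> space M. 2 < rank (transpose (Y \<omega>) ** Y \<omega>)}"
    by (rule AE_in_set_eq_1[OF ev, THEN iffD2, OF assms(11)])
  moreover have "AE \<omega> in M. full_rank (Y \<omega>)"
    by (rule gaussian_matrix_AE[OF assms(1,4) AE_full_rank])
  ultimately have good: "AE \<omega> in M. full_rank (Y \<omega>) \<and> 2 < rank (transpose (Y \<omega>) ** Y \<omega>)"
    by eventually_elim simp
  define h where "h \<omega> = ennreal ((norm (Y \<omega>))\<^sup>2) * inverse (ennreal ((norm ((pinv (Y \<omega>) ** Y \<omega>) *v X \<omega>))\<^sup>2))" for \<omega>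
  have [measurable]: "h \<in> borel_measurable M" unfolding h_def[abs_def] by measurable
  have h: "(\<integral>\<^sup>+\<omega>. h \<omega> \<partial>M) < \<infinity>"
    unfolding h_def by (rule inverse_projection_moment[OF assms(1) A assms(3-5) good])
  \<comment> \<open>Finiteness of \<open>h\<close> excludes \<open>P X = 0\<close> and with it a vanishing quadratic form.\<close>
  then have h_fin: "AE \<omega> in M. h \<omega> \<noteq> \<infinity>"
    by (intro nn_integral_PInf_AE) auto
  define F where "F \<omega> = (transpose (pinv (Y \<omega>)) *v X \<omega>) \<bullet> (transpose (pinv (Y \<omega>)) *v X \<omega>)" for \<omega>
  define d where "d = real CARD('n) + real CARD('p)"
  \<comment> \<open>Almost surely equal to the divergence, and a Borel function of \<open>X\<close> and \<open>Y\<close>.\<close>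
  define g where "g \<omega> = - 4 * r (F \<omega>) * deriv r (F \<omega>)
    + (r (F \<omega>))\<^sup>2 / F \<omega> * (d + 3 - 2 * trace (pinv (Y \<omega>) ** Y \<omega>))" for \<omega>
  have [measurable]: "F \<in> borel_measurable M" unfolding F_def[abs_def] by measurable
  have g_meas [measurable]: "g \<in> borel_measurable M" unfolding g_def[abs_def] by measurable
  have C: "0 \<le> C1" "0 \<le> C2" "0 \<le> d" using C1[of 0] C2[of 0] by (auto simp: d_def)
  have key: "diag_partials_exist (\<lambda>Z. Z ** H_mat r A Z (X \<omega>)) (Y \<omega> ** matrix_inv A)
      \<and> matrix_div (\<lambda>Z. Z ** H_mat r A Z (X \<omega>)) (Y \<omega> ** matrix_inv A) = g \<omega>
      \<and> ennreal \<bar>g \<omega>\<bar> \<le> ennreal (4 * C1 * C2) + ennreal (C1\<^sup>2 * (d + 3)) * h \<omega>"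
    if full: "full_rank (Y \<omega>)" and rank: "2 < rank (transpose (Y \<omega>) ** Y \<omega>)" and fin: "h \<omega> \<noteq> \<infinity>" for \<omega>
  proof -
    define y where "y = Y \<omega>"
    define P where "P = (mp_inverse y ** y) *v X \<omega>"
    have pinv: "pinv y = mp_inverse y" using full by (simp add: pinv_def y_def)
    have F: "F \<omega> = mp_coord (X \<omega>) y \<bullet> mp_coord (X \<omega>) y"
      by (simp add: F_def mp_coord_def pinv y_def[symmetric])
    have "transpose y ** y \<noteq> 0" using rank by (auto simp: y_def[symmetric])
    then have "y \<noteq> 0" by (metis bounded_bilinear.zero_right bounded_bilinear_matrix_matrix_mult)
    then have y: "0 < (norm y)\<^sup>2" by simp
    have "P \<noteq> 0"
    proof
      assume "P = 0"
      then have "h \<omega> = ennreal ((norm y)\<^sup>2) * \<infinity>"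
        by (simp add: h_def P_def pinv y_def[symmetric])
      then show False using y fin by (simp add: ennreal_mult_eq_top_iff)
    qed
    then have P: "0 < (norm P)\<^sup>2" by simp
    have le: "(norm P)\<^sup>2 \<le> (norm y)\<^sup>2 * F \<omega>"
      using quadratic_form_lower_bound[of y "X \<omega>"] full by (simp add: F P_def y_def)
    with P y have Fpos: "0 < F \<omega>" by (smt (verit) zero_less_mult_pos)
    have hh: "h \<omega> = ennreal ((norm y)\<^sup>2 / (norm P)\<^sup>2)"
      using P by (simp add: h_def P_def[symmetric] pinv y_def[symmetric] inverse_ennreal divide_inverse ennreal_mult)
    have inv_le: "1 / F \<omega> \<le> (norm y)\<^sup>2 / (norm P)\<^sup>2"
      using le Fpos P by (simp add: field_simps)
    have full': "full_rank (y ** matrix_inv A ** A)" using full by (simp add: ZA y_def)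
    have F': "mp_coord (X \<omega>) (y ** matrix_inv A ** A) \<bullet> mp_coord (X \<omega>) (y ** matrix_inv A ** A) \<noteq> 0"
      using Fpos by (simp add: F ZA)
    note div = matrix_div_formula[OF sym inv(2) full' rdiff F']
    let ?\<tau> = "trace (mp_inverse y ** y)"
    have \<tau>: "\<bar>d + 3 - 2 * ?\<tau>\<bar> \<le> d + 3"
      using trace_projection_bound[of y] full by (simp add: y_def d_def)
    have "\<bar>g \<omega>\<bar> \<le> \<bar>- 4 * r (F \<omega>) * deriv r (F \<omega>)\<bar> + \<bar>(r (F \<omega>))\<^sup>2 / F \<omega> * (d + 3 - 2 * ?\<tau>)\<bar>"
      unfolding g_def y_def[symmetric] pinv by (rule abs_triangle_ineq)
    also have "\<dots> = 4 * (r (F \<omega>) * \<bar>deriv r (F \<omega>)\<bar>) + (r (F \<omega>))\<^sup>2 * (1 / F \<omega>) * \<bar>d + 3 - 2 * ?\<tau>\<bar>"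
      using C1[of "F \<omega>"] Fpos by (simp add: abs_mult)
    also have "\<dots> \<le> 4 * (C1 * C2) + C1\<^sup>2 * ((norm y)\<^sup>2 / (norm P)\<^sup>2) * (d + 3)"
      using C1[of "F \<omega>"] C2[of "F \<omega>"] C Fpos
      by (intro add_mono mult_left_mono mult_mono power_mono inv_le \<tau>) auto
    finally have "\<bar>g \<omega>\<bar> \<le> 4 * C1 * C2 + C1\<^sup>2 * (d + 3) * ((norm y)\<^sup>2 / (norm P)\<^sup>2)"
      by (simp add: mult_ac)
    then have "ennreal \<bar>g \<omega>\<bar> \<le> ennreal (4 * C1 * C2 + C1\<^sup>2 * (d + 3) * ((norm y)\<^sup>2 / (norm P)\<^sup>2))"
      by (rule ennreal_leI)
    also have "\<dots> = ennreal (4 * C1 * C2) + ennreal (C1\<^sup>2 * (d + 3)) * h \<omega>"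
    proof -
      have "ennreal (a + b * q) = ennreal a + ennreal b * ennreal q" if "0 \<le> a" "0 \<le> b" "0 \<le> q" for a b q
        using that by (simp add: ennreal_mult)
      note split = this
      show ?thesis unfolding hh by (rule split) (use C in \<open>auto intro!: mult_nonneg_nonneg\<close>)
    qed
    finally have "ennreal \<bar>g \<omega>\<bar> \<le> ennreal (4 * C1 * C2) + ennreal (C1\<^sup>2 * (d + 3)) * h \<omega>" .
    moreover have "matrix_div (\<lambda>Z. Z ** H_mat r A Z (X \<omega>)) (y ** matrix_inv A) = g \<omega>"
      using div(2) by (simp add: g_def ZA F d_def pinv y_def[symmetric])
    ultimately show ?thesis using div(1) by (simp add: y_def)
  qed
  have AEkey: "AE \<omega> in M. diag_partials_exist (\<lambda>Z. Z ** H_mat r A Z (X \<omega>)) (Y \<omega> ** matrix_inv A)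
      \<and> matrix_div (\<lambda>Z. Z ** H_mat r A Z (X \<omega>)) (Y \<omega> ** matrix_inv A) = g \<omega>
      \<and> ennreal \<bar>g \<omega>\<bar> \<le> ennreal (4 * C1 * C2) + ennreal (C1\<^sup>2 * (d + 3)) * h \<omega>"
    using good h_fin by eventually_elim (rule key, auto)
  have "(\<integral>\<^sup>+\<omega>. ennreal \<bar>g \<omega>\<bar> \<partial>M) \<le> (\<integral>\<^sup>+\<omega>. ennreal (4 * C1 * C2) + ennreal (C1\<^sup>2 * (d + 3)) * h \<omega> \<partial>M)"
    using AEkey by (intro nn_integral_mono_AE) (auto elim: eventually_mono)
  also have "\<dots> = ennreal (4 * C1 * C2) + ennreal (C1\<^sup>2 * (d + 3)) * (\<integral>\<^sup>+\<omega>. h \<omega> \<partial>M)"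
    by (simp add: nn_integral_add nn_integral_cmult emeasure_space_1)
  also have "\<dots> < \<infinity>" using h by (simp add: ennreal_mult_less_top)
  finally have "integrable M g"
    by (intro integrableI_bounded) simp_all
  then have int: "integrable (completion M) (\<lambda>\<omega>. \<bar>g \<omega>\<bar>)"
    by (subst integrable_completion) auto
  have eq: "AE \<omega> in M. \<bar>matrix_div (\<lambda>Z. Z ** H_mat r A Z (X \<omega>)) (Y \<omega> ** matrix_inv A)\<bar> = \<bar>g \<omega>\<bar>"
    using AEkey by eventually_elim simp
  have "(\<lambda>\<omega>. \<bar>matrix_div (\<lambda>Z. Z ** H_mat r A Z (X \<omega>)) (Y \<omega> ** matrix_inv A)\<bar>) \<in> borel_measurable (completion M)"
    by (rule borel_measurable_completion_AE[OF _ eq]) measurable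
  then have "integrable (completion M)
      (\<lambda>\<omega>. \<bar>matrix_div (\<lambda>Z. Z ** H_mat r A Z (X \<omega>)) (Y \<omega> ** matrix_inv A)\<bar>)"
    using int AE_completion[OF eq] by (subst integrable_cong_AE) auto
  moreover have "AE \<omega> in M. diag_partials_exist (\<lambda>Z. Z ** H_mat r A Z (X \<omega>)) (Y \<omega> ** matrix_inv A)"
    using AEkey by eventually_elim simp
  ultimately show ?thesis by blast
qed

end
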